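(* Let $p$ be an odd prime, $m\ge 3$ an odd integer, $k$ a positive integer with $\gcd(m,k)=1$, and $\pi$ a primitive element of $\mathbb{F}_{p^m}$. Let $\mathrm{Tr}$ denote the trace map from $\mathbb{F}_{p^m}$ to $\mathbb{F}_p$. For $a,b,c\in\mathbb{F}_{p^m}$ define $$\mathbf{c}_{(a,b,c)}=\Big(\mathrm{Tr}\big(a\pi^{t}+b(-\pi)^{t}+c\,\pi^{(p^{k}+1)t/2}\big)\Big)_{t=0}^{p^{m}-2}\in\mathbb{F}_p^{\,p^m-1},$$ and let $\mathcal{C}_{(p,m,k)}=\{\mathbf{c}_{(a,b,c)}: a,b,c\in\mathbb{F}_{p^m}\}$. Then $\mathcal{C}_{(p,m,k)}$ is a cyclic code over $\mathbb{F}_p$ with parameters $[p^m-1,\,3m,\,\frac{p-1}{2}p^{m-1}]$ (length, dimension, minimum distance), and as $(a,b,c)$ runs through $\mathbb{F}_{p^m}^3$, the Hamming weight of $\mathbf{c}_{(a,b,c)}$ takes the following values with the following frequencies: - $0$: $1$ time; - $\frac{p-1}{2}p^{m-1}$: $2(p^m-1)$ times; - $\frac{p-1}{2}\big(2p^{m-1}-p^{\frac{m-1}{2}}\big)$: $(p^m-1)(p^m-p^{m-1})(p^{m-1}+p^{\frac{m-1}{2}})$ times; - $\frac{p-1}{2}\big(2p^{m-1}+p^{\frac{m-1}{2}}\big)$: $(p^m-1)(p^m-p^{m-1})(p^{m-1}-p^{\frac{m-1}{2}})$ times; - $(p-1)\big(p^{m-1}-p^{\frac{m-1}{2}}\big)$: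 $\frac14(p^m-1)(p^{m-1}+p^{\frac{m-1}{2}})^2$ times; - $(p-1)\big(p^{m-1}+p^{\frac{m-1}{2}}\big)$: $\frac14(p^m-1)(p^{m-1}-p^{\frac{m-1}{2}})^2$ times; - $(p-1)p^{m-1}$: $(p^m-1)\big(p^{2m}+\frac32p^{2(m-1)}-2p^{2m-1}+p^m-\frac12p^{m-1}-1\big)$ times.
   Context: Equivalently, $\mathcal{C}_{(p,m,k)}$ is the cyclic code of length $p^m-1$ whose parity-check polynomial is $h_0(x)h_1(x)h_2(x)$, where $h_0,h_1,h_2$ are the minimal polynomials over $\mathbb{F}_p$ of $\pi^{-1}$, $(-\pi)^{-1}$ and $\pi^{-(p^k+1)/2}$ respectively. The Hamming weight of a vector is its number of nonzero coordinates. *)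

theory Defs
  imports Complex_Main "HOL-Library.Cardinality" "HOL-Computational_Algebra.Primes"
begin

text \<open>The field F_{p^m} is modelled by a finite field type 'a with CARD('a) = p^m;
  the prime field F_p is its prime subfield, the image of of_nat.\<close>

definition prime_subfield :: "'a::field set" where
  "prime_subfield = range of_nat"

definition trace :: "nat \<Rightarrow> nat \<Rightarrow> 'a::field \<Rightarrow> 'a" where
  "trace p m x = (\<Sum>i<m. x ^ (p ^ i))"

definition primitive_element :: "'a::{finite,field} \<Rightarrow> bool" where
  "primitive_element \<pi> \<longleftrightarrow> \<pi> \<noteq> 0 \<and> (\<forall>x. x \<noteq> 0 \<longrightarrow> (\<exists>i::nat. \<pi> ^ i = x))"

text \<open>Vectors of length n over F_p are lists (entries in the prime subfield).\<close>

definition hamming_weight :: "'a::zero list \<Rightarrow> nat" where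
  "hamming_weight v = length (filter (\<lambda>x. x \<noteq> 0) v)"

definition codeword :: "nat \<Rightarrow> nat \<Rightarrow> nat \<Rightarrow> 'a::field \<Rightarrow> 'a \<Rightarrow> 'a \<Rightarrow> 'a \<Rightarrow> 'a list" where
  "codeword p m k \<pi> a b c =
     map (\<lambda>t. trace p m (a * \<pi> ^ t + b * (- \<pi>) ^ t + c * \<pi> ^ (((p ^ k + 1) div 2) * t)))
         [0..<p ^ m - 1]"

definition code_pmk :: "nat \<Rightarrow> nat \<Rightarrow> nat \<Rightarrow> 'a::{finite,field} \<Rightarrow> 'a list set" where
  "code_pmk p m k \<pi> = {codeword p m k \<pi> a b c | a b c. True}"

definition cyclic_code :: "nat \<Rightarrow> 'a::field list set \<Rightarrow> bool" where
  "cyclic_code n C \<longleftrightarrow>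
     (\<forall>v\<in>C. length v = n \<and> set v \<subseteq> prime_subfield) \<and>
     replicate n 0 \<in> C \<and>
     (\<forall>u\<in>C. \<forall>v\<in>C. map2 (+) u v \<in> C) \<and>
     (\<forall>s\<in>prime_subfield. \<forall>v\<in>C. map ((*) s) v \<in> C) \<and>
     (\<forall>v\<in>C. rotate1 v \<in> C)"

definition code_dim :: "nat \<Rightarrow> 'a list set \<Rightarrow> nat" where
  "code_dim p C = (THE d. card C = p ^ d)"

definition min_distance :: "'a::zero list set \<Rightarrow> nat" where
  "min_distance C = Min {hamming_weight v | v. v \<in> C \<and> (\<exists>x\<in>set v. x \<noteq> 0)}"

definition weight_freq :: "nat \<Rightarrow> nat \<Rightarrow> nat \<Rightarrow> 'a::{finite,field} \<Rightarrow> real \<Rightarrow> nat" where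
  "weight_freq p m k \<pi> w =
     card {(a, b, c). real (hamming_weight (codeword p m k \<pi> a b c)) = w}"

end

theory Submission
  imports Defs "HOL-Computational_Algebra.Polynomial"
begin

text \<open>Write \<open>u = a + b\<close> and \<open>v = (a - b) \<pi>\<close>. The even positions of a codeword run over the values of the
  quadratic form \<open>Tr (u x\<^sup>2 + c x ^ (p ^ k + 1))\<close> at \<open>x = \<pi> ^ s\<close>, the odd ones over those of the form
  with parameters \<open>v\<close> and \<open>c \<pi> ^ ((p ^ k + 1) / 2)\<close>, so twice the weight is the number of nonzeros of
  both forms. As \<open>gcd m k = 1\<close>, the radical of such a form with \<open>c \<noteq> 0\<close> has at most \<open>p\<^sup>2\<close> elements, hence
  the number of its zeros is \<open>p ^ (m - 1) + \<epsilon> (p - 1) p ^ ((m - 1) / 2)\<close> with \<open>\<epsilon>\<close> in \<open>{-1, 0, 1}\<close>.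
  For fixed \<open>c \<noteq> 0\<close> the first two moments over \<open>u\<close> of the number of zeros are found by counting, and
  they determine how often each \<open>\<epsilon>\<close> occurs.\<close>

text \<open>The obstacle is the bound on the radical. Its equation has degree p ^ (2 * k) in x, so
  counting roots by degree is useless for k > 1. Instead one solution is factored out, which leaves
  two equations of first order in x ^ (p ^ k); the fixed points of this power map form the prime
  field because gcd m k = 1. Oddness of m enters twice. Only even rank moves the number of zeros
  away from p ^ (m - 1), and among radicals of size p ^ d with d at most 2 it forces d = 1, so one
  magnitude occurs. Moreover a square root of an element of the prime field lies in the prime field,
  hence x^2 and y^2 are proportional over it only if x and y are; the second moment becomes a count
  of independent linear conditions on u. The total and the two moments are three equations for three
  frequencies, and their solution does not depend on c. As (a, b) and (u, v) determine each other,
  the types for c nonzero follow the convolution of this one distribution with itself. For c = 0 the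
  form Tr (u x^2) has odd rank m, or is zero for u = 0, and is treated apart.\<close>

lemma finite_field_power_CARD:
  fixes x :: "'a::{finite,field}"
  shows "x ^ CARD('a) = x"
proof (cases "x = 0")
  case False
  let ?P = "\<Prod>y\<in>UNIV - {0::'a}. y"
  \<comment> \<open>Multiplication by \<open>x\<close> permutes the nonzero elements; their product
    is then cancelled.\<close>
  have "?P = (\<Prod>y\<in>UNIV - {0}. x * y)"
    by (rule prod.reindex_bij_witness[of _ "\<lambda>y. x * y" "\<lambda>y. y / x"]) (use False in auto)
  also have "\<dots> = x ^ (CARD('a) - 1) * ?P"
    by (simp add: prod.distrib card_Diff_subset)
  finally have "x ^ (CARD('a) - 1) = 1"
    by simp
  then show ?thesis
    by (metis One_nat_def Suc_pred' mult.right_neutral power_Suc zero_less_card_finite)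
qed simp

text \<open>The square root is sought in the whole field. For an element of the prime field this makes no
  difference, as the extension degree is odd (\<open>F_sqrt\<close> below).\<close>
definition quad_char :: "'a::field \<Rightarrow> int" where
  "quad_char x = (if x = 0 then 0 else if \<exists>y. y\<^sup>2 = x then 1 else - 1)"

lemma quad_char_0 [simp]: "quad_char 0 = 0"
  by (simp add: quad_char_def)

lemma quad_char_cases: "x \<noteq> 0 \<Longrightarrow> quad_char x = 1 \<or> quad_char x = - 1"
  by (auto simp: quad_char_def)

text \<open>These are the subspaces over the prime field: its elements are the natural multiples of
  1, so sums already give closure under scalars and negation.\<close>

definition add_closed :: "'a::{finite,field} set \<Rightarrow> bool" where
  "add_closed V \<longleftrightarrow> 0 \<in> V \<and> (\<forall>x\<in>V. \<forall>y\<in>V. x + y \<in> V)"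

definition polar :: "('a::field \<Rightarrow> 'a) \<Rightarrow> 'a \<Rightarrow> 'a \<Rightarrow> 'a" where
  "polar Q x y = Q (x + y) - Q x - Q y"

text \<open>Additivity of \<open>polar\<close> in one argument amounts to bilinearity over the prime
  field, by \<open>polar_commute\<close> and \<open>additive_scale\<close>.\<close>

definition quad_form :: "('a::field \<Rightarrow> 'a) \<Rightarrow> bool" where
  "quad_form Q \<longleftrightarrow> (\<forall>x. Q x \<in> prime_subfield) \<and>
     (\<forall>t\<in>prime_subfield. \<forall>x. Q (t * x) = t\<^sup>2 * Q x) \<and>
     (\<forall>x y z. polar Q (x + y) z = polar Q x z + polar Q y z)"

text \<open>Taken relative to \<open>V\<close>, because the induction in
  \<open>quad_form_count\<close> descends through subspaces.\<close>

definition radical :: "('a::field \<Rightarrow> 'a) \<Rightarrow> 'a set \<Rightarrow> 'a set" where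
  "radical Q V = {x \<in> V. \<forall>y\<in>V. polar Q x y = 0}"

lemma polar_commute: "polar Q x y = polar Q y x"
  by (simp add: polar_def algebra_simps)

section \<open>The field of odd degree and its prime field\<close>

locale odd_degree_field =
  fixes \<pi> :: "'a::{finite,field}" and p m :: nat
  assumes prime_p: "prime p" and odd_p: "odd p"
    and card_UNIV: "CARD('a) = p ^ m"
    and odd_m: "odd m"
    and primitive: "primitive_element \<pi>"
begin

abbreviation "F \<equiv> prime_subfield :: 'a set"
abbreviation "tr \<equiv> trace p m :: 'a \<Rightarrow> 'a"

lemma p_ge_3: "p \<ge> 3"
  using prime_p odd_p prime_ge_2_nat[of p] by (cases "p = 2") auto

text \<open>Translation by 1 permutes the field, so \<open>CARD('a)\<close> copies of 1 sum to 0,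
  and the characteristic, a prime, divides \<open>p ^ m\<close>.\<close>

lemma CHAR_eq: "CHAR('a) = p"
proof -
  have "(\<Sum>x\<in>UNIV. x + (1::'a)) = (\<Sum>x\<in>UNIV. x)"
    by (rule sum.reindex_bij_witness[of _ "\<lambda>x. x - 1" "\<lambda>x. x + 1"]) auto
  then have "of_nat CARD('a) = (0::'a)"
    by (simp add: sum.distrib)
  then have *: "CHAR('a) dvd p ^ m"
    by (metis of_nat_eq_0_iff_char_dvd card_UNIV)
  have "CHAR('a) > 0" by (rule finite_imp_CHAR_pos) simp
  then have "prime CHAR('a)" by (rule prime_CHAR_semidom)
  then show ?thesis
    using * prime_p prime_dvd_power primes_dvd_imp_eq by blast
qed

lemma frob_add: "(x + y :: 'a) ^ (p ^ i) = x ^ (p ^ i) + y ^ (p ^ i)"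
  by (rule freshmans_dream') (use prime_p in \<open>auto simp: CHAR_eq\<close>)

lemma frob_add1: "(x + y :: 'a) ^ p = x ^ p + y ^ p"
  using frob_add[of x y 1] by simp

lemma frob_minus: "(- x :: 'a) ^ (p ^ i) = - (x ^ (p ^ i))"
  using odd_p by simp

lemma frob_diff: "(x - y :: 'a) ^ (p ^ i) = x ^ (p ^ i) - y ^ (p ^ i)"
  using frob_add[of x "- y" i] frob_minus[of y i] by simp

lemma power_p_pow_mult_m: "(x :: 'a) ^ (p ^ (m * i)) = x"
proof (induction i)
  case (Suc i)
  have "x ^ (p ^ (m * Suc i)) = (x ^ (p ^ (m * i))) ^ CARD('a)"
    by (simp add: card_UNIV power_add mult.commute flip: power_mult)
  then show ?case
    using Suc finite_field_power_CARD by metis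
qed simp

lemma power_p_pow_m: "(x :: 'a) ^ (p ^ m) = x"
  using power_p_pow_mult_m[of x 1] by simp

lemma two_nonzero: "(2 :: 'a) \<noteq> 0"
proof
  assume "(2 :: 'a) = 0"
  then have "of_nat 2 = (0::'a)" by simp
  then have "p dvd 2" by (simp only: of_nat_eq_0_iff_char_dvd CHAR_eq)
  then show False using p_ge_3 by (auto dest: dvd_imp_le)
qed

lemma neq_minus: "x \<noteq> 0 \<Longrightarrow> (x :: 'a) \<noteq> - x"
proof
  assume "x \<noteq> 0" "x = - x"
  then have "2 * x = 0" by (simp add: eq_neg_iff_add_eq_0)
  then show False using two_nonzero \<open>x \<noteq> 0\<close> by simp
qed

text \<open>The residues below \<open>p\<close> stay distinct in the field, so \<open>F\<close> has
  \<open>p\<close> elements. All of them are roots of \<open>x ^ p - x\<close>, which has no room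
  for another root.\<close>

lemma card_F: "card F = p" and in_F_iff: "x \<in> F \<longleftrightarrow> x ^ p = x"
proof -
  have p0: "p > 0" using p_ge_3 by simp
  have Fim: "F = of_nat ` {..<p}"
  proof -
    have "of_nat n = (of_nat (n mod p) :: 'a)" for n
    proof -
      have "of_nat n = (of_nat (p * (n div p) + n mod p) :: 'a)" by simp
      also have "\<dots> = of_nat (n mod p)"
        unfolding of_nat_add of_nat_mult using of_nat_CHAR[where ?'a = 'a] CHAR_eq by simp
      finally show ?thesis .
    qed
    then show ?thesis
      unfolding prime_subfield_def using p0 by (auto intro!: image_eqI[where x = "n mod p" for n])
  qed
  have "inj_on (of_nat :: nat \<Rightarrow> 'a) {..<p}"
  proof (rule linorder_inj_onI)
    fix x y assume "x < y" "x \<in> {..<p}" "y \<in> {..<p}"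
    then show "of_nat x \<noteq> (of_nat y :: 'a)"
      using of_nat_eq_iff_char_dvd[of x y, where ?'a = 'a] CHAR_eq by (auto dest: dvd_imp_le)
  qed auto
  then show card: "card F = p" by (simp add: Fim card_image)
  let ?q = "monom 1 p - monom 1 1 :: 'a poly"
  have q0: "coeff ?q p \<noteq> 0" using p_ge_3 by simp
  have deg: "degree ?q \<le> p"
    by (rule degree_diff_le; rule order.trans[OF degree_monom_le]) (use p_ge_3 in auto)
  have "card {x. poly ?q x = 0} \<le> degree ?q"
    by (rule card_poly_roots_bound) (metis q0 coeff_0)
  then have le: "card {x::'a. x ^ p = x} \<le> p"
    using deg by (simp add: poly_monom)
  have "(of_nat n :: 'a) ^ p = of_nat n" for n
    using p0 by (induction n) (auto simp: frob_add1)
  then have "F \<subseteq> {x. x ^ p = x}" by (auto simp: prime_subfield_def)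
  then have "F = {x. x ^ p = x}"
    by (rule card_seteq[rotated]) (use le card in auto)
  then show "x \<in> F \<longleftrightarrow> x ^ p = x" by auto
qed

lemma F_0 [simp, intro]: "0 \<in> F" and F_1 [simp, intro]: "1 \<in> F"
  using p_ge_3 by (auto simp: in_F_iff)

lemma F_add [intro]: "x \<in> F \<Longrightarrow> y \<in> F \<Longrightarrow> x + y \<in> F"
  by (simp add: in_F_iff frob_add1)

lemma F_minus [intro]: "x \<in> F \<Longrightarrow> - x \<in> F"
  using odd_p by (simp add: in_F_iff)

lemma F_diff [intro]: "x \<in> F \<Longrightarrow> y \<in> F \<Longrightarrow> x - y \<in> F"
  using F_add[of x "- y"] by auto

lemma F_mult [intro]: "x \<in> F \<Longrightarrow> y \<in> F \<Longrightarrow> x * y \<in> F"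
  by (simp add: in_F_iff power_mult_distrib)

lemma F_divide [intro]: "x \<in> F \<Longrightarrow> y \<in> F \<Longrightarrow> x / y \<in> F"
  by (simp add: in_F_iff power_divide)

lemma F_power [intro]: "x \<in> F \<Longrightarrow> x ^ i \<in> F"
  by (induction i) auto

lemma F_2 [simp, intro]: "2 \<in> F"
  using F_add[OF F_1 F_1] by simp

lemma F_frob: "t \<in> F \<Longrightarrow> t ^ (p ^ i) = t"
  by (induction i) (auto simp: in_F_iff power_mult)

text \<open>A square root outside \<open>F\<close> would generate an extension of degree 2 inside
  one of odd degree. In terms of powers: \<open>y ^ p = - y\<close>, iterated \<open>m\<close>
  times, gives \<open>y = - y\<close>.\<close>

lemma F_sqrt:
  assumes "y\<^sup>2 \<in> F" shows "y \<in> F"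
proof -
  have "(y ^ p)\<^sup>2 = y\<^sup>2" using assms by (metis in_F_iff mult.commute power_mult)
  then have "y ^ p = y \<or> y ^ p = - y" by (simp add: power2_eq_iff)
  moreover have "y = 0" if *: "y ^ p = - y"
  proof -
    have "y ^ (p ^ i) = (- 1) ^ i * y" for i
    proof (induction i)
      case (Suc i)
      have "y ^ (p ^ Suc i) = (y ^ (p ^ i)) ^ p" by (simp add: mult.commute flip: power_mult)
      also have "\<dots> = ((- 1) ^ p) ^ i * y ^ p"
        using Suc by (simp add: power_mult_distrib mult.commute flip: power_mult)
      also have "\<dots> = (- 1) ^ Suc i * y" using odd_p * by simp
      finally show ?case .
    qed simp
    from this[of m] have "y = - y" using odd_m power_p_pow_m by simp
    then show ?thesis using neq_minus by blast
  qed
  ultimately show ?thesis using in_F_iff by auto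
qed

subsection \<open>The trace\<close>

lemma tr_add: "tr (x + y) = tr x + tr y"
  by (simp add: trace_def frob_add sum.distrib)

lemma tr_0 [simp]: "tr 0 = 0"
  using p_ge_3 by (simp add: trace_def power_0_left)

lemma tr_minus: "tr (- x) = - tr x"
  using tr_add[of x "- x"] by (simp add: eq_neg_iff_add_eq_0 add.commute)

lemma tr_diff: "tr (x - y) = tr x - tr y"
  using tr_add[of x "- y"] by (simp add: tr_minus)

lemma tr_scale: "t \<in> F \<Longrightarrow> tr (t * x) = t * tr x"
  by (simp add: trace_def power_mult_distrib F_frob sum_distrib_left)

text \<open>Raising to the power \<open>p\<close> permutes the summands of the trace cyclically, as
  \<open>x ^ (p ^ m) = x\<close>.\<close>

lemma tr_shift: "(\<Sum>i<m. x ^ (p ^ Suc i)) = tr x"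
proof -
  have "(\<Sum>i<m. x ^ (p ^ Suc i)) + x ^ (p ^ 0) = (\<Sum>i<Suc m. x ^ (p ^ i))"
    by (subst sum.lessThan_Suc_shift) simp
  then show ?thesis by (simp add: trace_def power_p_pow_m)
qed

lemma tr_frob: "tr (x ^ (p ^ i)) = tr x"
proof (induction i)
  case (Suc i)
  have "tr (x ^ (p ^ Suc i)) = (\<Sum>j<m. (x ^ (p ^ i)) ^ (p ^ Suc j))"
    unfolding trace_def by (intro sum.cong refl) (simp add: mult_ac flip: power_mult)
  then show ?case using Suc tr_shift by simp
qed simp

lemma tr_in_F [simp, intro]: "tr x \<in> F"
proof -
  have "tr x ^ p = (\<Sum>i<m. (x ^ (p ^ i)) ^ p)"
    unfolding trace_def by (rule freshmans_dream_sum) (use prime_p CHAR_eq in auto)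
  also have "\<dots> = tr x"
    using tr_shift[of x] by (simp add: mult.commute flip: power_mult)
  finally show ?thesis by (simp add: in_F_iff)
qed

text \<open>As a polynomial the trace is nonzero of degree at most \<open>p ^ (m - 1)\<close>, too
  small to vanish at \<open>p ^ m\<close> elements.\<close>

lemma tr_nonzero: "\<exists>x. tr x \<noteq> 0"
proof (rule ccontr)
  assume "\<not> ?thesis"
  then have 0: "tr x = 0" for x by simp
  obtain l where l: "m = Suc l" using odd_m by (cases m) auto
  let ?q = "\<Sum>i<m. monom 1 (p ^ i) :: 'a poly"
  have "coeff ?q (p ^ l) = (\<Sum>i<m. if i = l then 1 else 0)"
    unfolding coeff_sum coeff_monom by (intro sum.cong refl) (use p_ge_3 in \<open>auto\<close>)
  then have q0: "coeff ?q (p ^ l) \<noteq> 0" by (simp add: l)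
  have deg: "degree ?q \<le> p ^ l"
    by (rule degree_sum_le) (use l p_ge_3 in \<open>auto intro!: order.trans[OF degree_monom_le] power_increasing\<close>)
  have "card {x. poly ?q x = 0} \<le> degree ?q"
    by (rule card_poly_roots_bound) (use q0 in auto)
  moreover have "poly ?q x = 0" for x
    using 0[of x] by (simp add: poly_sum poly_monom trace_def)
  ultimately have "p ^ m \<le> p ^ l" using deg card_UNIV by simp
  then show False using p_ge_3 by (simp add: l)
qed

lemma tr_nondegenerate:
  assumes "\<And>w. tr (w * z) = 0" shows "z = 0"
proof (rule ccontr)
  assume "z \<noteq> 0"
  then have "tr x = 0" for x using assms[of "x / z"] by simp
  then show False using tr_nonzero by simp
qed

subsection \<open>The quadratic character\<close>

lemma pi_nonzero: "\<pi> \<noteq> 0"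
  using primitive by (simp add: primitive_element_def)

lemma pi_power_n: "\<pi> ^ (p ^ m - 1) = 1"
proof -
  have "\<pi> * \<pi> ^ (p ^ m - 1) = \<pi> ^ Suc (p ^ m - 1)" by simp
  also have "Suc (p ^ m - 1) = p ^ m" using p_ge_3 by simp
  finally show ?thesis using pi_nonzero by (simp add: power_p_pow_m)
qed

lemma p_pow_m_ge: "p ^ m \<ge> 3"
  using p_ge_3 odd_m self_le_power[of p m] by (auto simp: odd_pos)

text \<open>Exponents can be reduced modulo \<open>p ^ m - 1\<close>, so those below it already
  reach every nonzero element; equal cardinalities then give injectivity.\<close>

lemma bij_betw_pi_power: "bij_betw (\<lambda>i. \<pi> ^ i) {..<p ^ m - 1} (UNIV - {0})"
proof -
  let ?n = "p ^ m - 1"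
  have n0: "?n > 0" using p_pow_m_ge by simp
  have "\<pi> ^ i = \<pi> ^ (i mod ?n)" for i
  proof -
    have "\<pi> ^ i = \<pi> ^ (?n * (i div ?n) + i mod ?n)" by simp
    also have "\<dots> = \<pi> ^ (i mod ?n)"
      unfolding power_add power_mult pi_power_n by simp
    finally show ?thesis .
  qed
  then have "\<exists>i<?n. \<pi> ^ i = x" if "x \<noteq> 0" for x
    using primitive n0 that unfolding primitive_element_def by (metis mod_less_divisor)
  then have im: "(\<lambda>i. \<pi> ^ i) ` {..<?n} = UNIV - {0}"
    using pi_nonzero by (fastforce simp: image_iff)
  moreover have "inj_on (\<lambda>i. \<pi> ^ i) {..<?n}"
    by (rule eq_card_imp_inj_on) (simp_all only: im finite_lessThan, simp add: card_Diff_subset card_UNIV)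
  ultimately show ?thesis by (simp add: bij_betw_def)
qed

lemma pi_power_half: "\<pi> ^ ((p ^ m - 1) div 2) = - 1"
proof -
  let ?M = "(p ^ m - 1) div 2"
  have ev: "p ^ m - 1 = 2 * ?M" using odd_p by simp
  have "(\<pi> ^ ?M)\<^sup>2 = 1"
    using pi_power_n ev by (metis mult.commute power_mult)
  then have "\<pi> ^ ?M = 1 \<or> \<pi> ^ ?M = - 1" by (simp add: power2_eq_1_iff)
  moreover have "\<pi> ^ ?M \<noteq> \<pi> ^ 0"
  proof
    assume "\<pi> ^ ?M = \<pi> ^ 0"
    then have "?M = 0"
      by (rule inj_onD[OF bij_betw_imp_inj_on[OF bij_betw_pi_power]]) (use p_pow_m_ge in auto)
    then show False using p_pow_m_ge by simp
  qed
  ultimately show ?thesis by simp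
qed

lemma pi_powerE: assumes "x \<noteq> 0" obtains i where "x = \<pi> ^ i"
  using primitive assms unfolding primitive_element_def by metis

lemma quad_char_pi_power: "quad_char (\<pi> ^ i) = (- 1) ^ i"
proof (cases "even i")
  case True
  then obtain j where "i = 2 * j" by blast
  then have "(\<pi> ^ j)\<^sup>2 = \<pi> ^ i" by (simp add: mult.commute flip: power_mult)
  then show ?thesis using True pi_nonzero by (auto simp: quad_char_def)
next
  case False
  let ?M = "(p ^ m - 1) div 2"
  have ev: "p ^ m - 1 = 2 * ?M" using odd_p by simp
  have "y\<^sup>2 \<noteq> \<pi> ^ i" for y
  proof
    assume *: "y\<^sup>2 = \<pi> ^ i"
    then have "y \<noteq> 0" using pi_nonzero by auto
    then obtain j where "y = \<pi> ^ j" using pi_powerE by blast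
    \<comment> \<open>The equation \<open>*\<close> raised to the power \<open>?M\<close>: the left
      side is 1, the right side \<open>(- 1) ^ i\<close>.\<close>
    then have "(\<pi> ^ (p ^ m - 1)) ^ j = (\<pi> ^ ?M) ^ i"
      using * ev by (metis (no_types, lifting) mult.commute mult.left_commute power_mult)
    then show False
      unfolding pi_power_half pi_power_n using False neq_minus[of 1] by simp
  qed
  then show ?thesis using False pi_nonzero by (auto simp: quad_char_def)
qed

lemma quad_char_mult: "quad_char (x * y) = quad_char x * quad_char (y :: 'a)"
proof (cases "x = 0 \<or> y = 0")
  case False
  then obtain i j where "x = \<pi> ^ i" "y = \<pi> ^ j" using pi_powerE by metis
  then show ?thesis by (metis quad_char_pi_power power_add)
qed (auto simp: quad_char_def)

lemma quad_char_divide: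
  assumes "a \<noteq> 0" shows "quad_char (x / a :: 'a) = quad_char x * quad_char a"
proof -
  have "quad_char x = quad_char (x / a) * quad_char a"
    using assms by (simp flip: quad_char_mult)
  then show ?thesis using quad_char_cases[OF assms] by auto
qed

text \<open>\<open>quad_char\<close> looks for roots in the whole field; by \<open>F_sqrt\<close>
  the roots of an element of \<open>F\<close> lie in \<open>F\<close>.\<close>

lemma card_sqrt_F:
  assumes "j \<in> F" shows "int (card {t \<in> F. t\<^sup>2 = j}) = 1 + quad_char j"
proof -
  consider "j = 0" | "j \<noteq> 0" "\<exists>y. y\<^sup>2 = j" | "j \<noteq> 0" "\<not> (\<exists>y. y\<^sup>2 = j)" by blast
  then show ?thesis
  proof cases
    case 1
    then have "{t \<in> F. t\<^sup>2 = j} = {0}" by auto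
    then show ?thesis using 1 by simp
  next
    case 2
    then obtain y where y: "y\<^sup>2 = j" by blast
    then have "y \<in> F" using F_sqrt assms by blast
    then have "{t \<in> F. t\<^sup>2 = j} = {y, - y}" using y by (auto simp: power2_eq_iff)
    moreover have "y \<noteq> - y" by (rule neq_minus) (use 2 y in auto)
    ultimately show ?thesis using 2 by (simp add: quad_char_def)
  next
    case 3
    then have "{t \<in> F. t\<^sup>2 = j} = {}" by blast
    then show ?thesis using 3 by (simp add: quad_char_def)
  qed
qed

lemma card_scaled_sqrt_F:
  assumes "j \<in> F" "a \<in> F" "a \<noteq> 0"
  shows "int (card {t \<in> F. a * t\<^sup>2 = j}) = 1 + quad_char j * quad_char a"
proof -
  have "{t \<in> F. a * t\<^sup>2 = j} = {t \<in> F. t\<^sup>2 = j / a}"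
    using assms by (auto simp: nonzero_eq_divide_eq mult.commute)
  then show ?thesis
    using assms card_sqrt_F[of "j / a"] by (simp add: quad_char_divide F_divide)
qed

lemma card_hyperbola:
  assumes "c \<in> F"
  shows "card {(u, v) \<in> F \<times> F. u * v = c} = (p - 1) + (if c = 0 then p else 0)"
proof -
  have "{(u, v) \<in> F \<times> F. u * v = c} = (SIGMA u:F. {v \<in> F. u * v = c})" by auto
  then have "card {(u, v) \<in> F \<times> F. u * v = c} = (\<Sum>u\<in>F. card {v \<in> F. u * v = c})"
    by (simp add: card_SigmaI)
  also have "\<dots> = (\<Sum>u\<in>F - {0}. card {v \<in> F. u * v = c}) + card {v \<in> F. 0 * v = c}"
    by (subst sum.remove[of F 0]) auto
  also have "(\<Sum>u\<in>F - {0}. card {v \<in> F. u * v = c}) = (\<Sum>u\<in>F - {0}. 1)"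
  proof (rule sum.cong)
    fix u assume u: "u \<in> F - {0}"
    then have "{v \<in> F. u * v = c} = {c / u}" using assms by (auto simp: F_divide)
    then show "card {v \<in> F. u * v = c} = 1" by simp
  qed simp
  also have "\<dots> = p - 1" by (simp add: card_Diff_subset card_F)
  also have "card {v \<in> F. 0 * v = c} = (if c = 0 then p else 0)"
    by (auto simp: card_F)
  finally show ?thesis .
qed

text \<open>Adding 1 to each character value counts the \<open>s\<close> with
  \<open>s\<^sup>2 = t\<^sup>2 - c\<close>. The sum is thus a point count on a conic, which the
  coordinates \<open>t - s\<close> and \<open>t + s\<close> turn into
  \<open>u * v = c\<close>.\<close>

lemma sum_quad_char_square_minus:
  assumes "c \<in> F"
  shows "(\<Sum>t\<in>F. quad_char (t\<^sup>2 - c)) = (if c = 0 then int p else 0) - 1"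
proof -
  have "int p + (\<Sum>t\<in>F. quad_char (t\<^sup>2 - c)) = (\<Sum>t\<in>F. 1 + quad_char (t\<^sup>2 - c))"
    by (simp add: sum.distrib card_F)
  also have "\<dots> = (\<Sum>t\<in>F. int (card {s \<in> F. s\<^sup>2 = t\<^sup>2 - c}))"
    by (intro sum.cong refl card_sqrt_F[symmetric]) (use assms in auto)
  also have "\<dots> = int (card (SIGMA t:F. {s \<in> F. s\<^sup>2 = t\<^sup>2 - c}))"
    by (simp add: card_SigmaI)
  also have "card (SIGMA t:F. {s \<in> F. s\<^sup>2 = t\<^sup>2 - c}) = card {(u, v) \<in> F \<times> F. u * v = c}"
  proof (rule bij_betw_same_card)
    show "bij_betw (\<lambda>(t, s). (t - s, t + s)) (SIGMA t:F. {s \<in> F. s\<^sup>2 = t\<^sup>2 - c})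
            {(u, v) \<in> F \<times> F. u * v = c}"
    proof (rule bij_betw_byWitness[where f' = "\<lambda>(u, v). ((u + v) / 2, (v - u) / 2)"])
      show "(\<lambda>(u, v). ((u + v) / 2, (v - u) / 2)) ` {(u, v) \<in> F \<times> F. u * v = c}
              \<subseteq> (SIGMA t:F. {s \<in> F. s\<^sup>2 = t\<^sup>2 - c})"
      proof (clarsimp, intro conjI)
        fix a b assume ab: "a \<in> F" "b \<in> F" "c = a * b"
        show "(a + b) / 2 \<in> F" "(b - a) / 2 \<in> F" using ab by (auto intro!: F_divide)
        have "4 * (((a + b) / 2)\<^sup>2 - ((b - a) / 2)\<^sup>2) = (2 * ((a + b) / 2))\<^sup>2 - (2 * ((b - a) / 2))\<^sup>2"
          by (simp only: power_mult_distrib right_diff_distrib) simp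
        also have "\<dots> = (a + b)\<^sup>2 - (b - a)\<^sup>2"
          using two_nonzero by (simp del: distrib_left_numeral right_diff_distrib_numeral)
        also have "\<dots> = 4 * (a * b)" by (simp add: power2_eq_square algebra_simps)
        finally have "2 * (2 * (((a + b) / 2)\<^sup>2 - ((b - a) / 2)\<^sup>2)) = 2 * (2 * (a * b))" by simp
        then have "((a + b) / 2)\<^sup>2 - ((b - a) / 2)\<^sup>2 = a * b"
          using two_nonzero by (metis mult_left_cancel)
        then show "((b - a) / 2)\<^sup>2 = ((a + b) / 2)\<^sup>2 - a * b" by (simp add: algebra_simps)
      qed
    next
      show "\<forall>x\<in>(SIGMA t:F. {s \<in> F. s\<^sup>2 = t\<^sup>2 - c}).
              (\<lambda>(u, v). ((u + v) / 2, (v - u) / 2)) ((\<lambda>(t, s). (t - s, t + s)) x) = x"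
        using two_nonzero by (auto simp: mult_2[symmetric])
      show "\<forall>x\<in>{(u, v) \<in> F \<times> F. u * v = c}.
              (\<lambda>(t, s). (t - s, t + s)) ((\<lambda>(u, v). ((u + v) / 2, (v - u) / 2)) x) = x"
        using two_nonzero by (auto simp: diff_divide_distrib[symmetric] add_divide_distrib[symmetric] mult_2[symmetric])
    qed (auto simp: power2_eq_square algebra_simps)
  qed
  finally show ?thesis
    using card_hyperbola[OF assms] p_ge_3 by (auto split: if_splits)
qed

lemma sum_quad_char_minus_scaled_square:
  assumes "j \<in> F" "a \<in> F" "a \<noteq> 0"
  shows "(\<Sum>t\<in>F. quad_char (j - a * t\<^sup>2)) = quad_char (- a) * ((if j = 0 then int p else 0) - 1)"
proof -
  have "quad_char (j - a * t\<^sup>2) = quad_char (- a) * quad_char (t\<^sup>2 - j / a)" for t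
    unfolding quad_char_mult[symmetric] using assms by (simp add: right_diff_distrib)
  then have "(\<Sum>t\<in>F. quad_char (j - a * t\<^sup>2)) = quad_char (- a) * (\<Sum>t\<in>F. quad_char (t\<^sup>2 - j / a))"
    by (simp add: sum_distrib_left)
  then show ?thesis
    using assms sum_quad_char_square_minus[of "j / a"] by (auto simp: F_divide)
qed

subsection \<open>Quadratic forms over the prime field\<close>

lemma additive_scale:
  fixes f :: "'a \<Rightarrow> 'a"
  assumes f: "\<And>x y. f (x + y) = f x + f y" and t: "t \<in> F"
  shows "f (t * x) = t * f x"
proof -
  have "f 0 = 0" using f[of 0 0] by (metis add_cancel_right_right)
  then have "f (of_nat n * x) = of_nat n * f x" for n
    by (induction n) (simp_all add: f distrib_right)
  then show ?thesis using t by (auto simp: prime_subfield_def)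
qed

lemma add_closed_scale:
  fixes V :: "'a set"
  assumes "add_closed V" "t \<in> F" "x \<in> V"
  shows "t * x \<in> V"
proof -
  have "of_nat n * x \<in> V" for n
    using assms by (induction n) (auto simp: add_closed_def distrib_right)
  then show ?thesis using assms by (auto simp: prime_subfield_def)
qed

lemma add_closed_diff:
  fixes V :: "'a set"
  assumes "add_closed V" "x \<in> V" "y \<in> V"
  shows "x - y \<in> V"
proof -
  have "- 1 * y \<in> V" by (rule add_closed_scale) (use assms in auto)
  then have "x + - 1 * y \<in> V" using assms unfolding add_closed_def by blast
  then show ?thesis by simp
qed

text \<open>\<open>V\<close> is the direct sum of the line through \<open>e\<close> and the kernel
  of \<open>f\<close> on \<open>V\<close>; the coefficient \<open>f x / f e\<close> is the one that
  puts the remainder into the kernel.\<close>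

lemma bij_betw_split:
  fixes f :: "'a \<Rightarrow> 'a"
  assumes V: "add_closed V" and e: "e \<in> V"
    and f: "\<And>x y. f (x + y) = f x + f y" and fF: "\<And>x. f x \<in> F" and fe: "f e \<noteq> 0"
  shows "bij_betw (\<lambda>(t, w). t * e + w) (F \<times> {x \<in> V. f x = 0}) V"
proof (rule bij_betw_byWitness[where f' = "\<lambda>x. (f x / f e, x - f x / f e * e)"])
  have fs: "f (t * x) = t * f x" if "t \<in> F" for t x using additive_scale[of f] f that by blast
  have fd: "f (x - y) = f x - f y" for x y using f[of "x - y" y] by simp
  show "\<forall>x\<in>F \<times> {x \<in> V. f x = 0}.
      (\<lambda>x. (f x / f e, x - f x / f e * e)) ((\<lambda>(t, w). t * e + w) x) = x"
    using fe by (auto simp: f fs)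
  show "\<forall>x\<in>V. (\<lambda>(t, w). t * e + w) (f x / f e, x - f x / f e * e) = x" by simp
  show "(\<lambda>(t, w). t * e + w) ` (F \<times> {x \<in> V. f x = 0}) \<subseteq> V"
    using V e add_closed_scale by (auto simp: add_closed_def)
  show "(\<lambda>x. (f x / f e, x - f x / f e * e)) ` V \<subseteq> F \<times> {x \<in> V. f x = 0}"
  proof clarsimp
    fix x assume x: "x \<in> V"
    have c: "f x / f e \<in> F" using fF by auto
    have "f x / f e * e \<in> V" using V e c add_closed_scale by blast
    moreover have "f (f x / f e * e) = f x" using fs[OF c] fe by simp
    ultimately show "f x / f e \<in> F \<and> x - f x * e / f e \<in> V \<and> f (x - f x * e / f e) = 0"
      using c x V add_closed_diff by (simp add: fd)
  qed
qed

lemma card_additive_fibre: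
  fixes f :: "'a \<Rightarrow> 'a"
  assumes V: "add_closed V" and e: "e \<in> V"
    and f: "\<And>x y. f (x + y) = f x + f y" and fF: "\<And>x. f x \<in> F" and fe: "f e \<noteq> 0"
    and j: "j \<in> F"
  shows "p * card {x \<in> V. f x = j} = card V"
proof -
  have fs: "f (t * x) = t * f x" if "t \<in> F" for t x using additive_scale[of f] f that by blast
  have fd: "f (x - y) = f x - f y" for x y using f[of "x - y" y] by simp
  \<comment> \<open>A point of \<open>V\<close> above \<open>j\<close>; translation by it carries
    the kernel to the fibre.\<close>
  define g where "g = j / f e * e"
  have jf: "j / f e \<in> F" using j fF by auto
  have g: "g \<in> V" "f g = j"
    unfolding g_def using fe by (simp_all only: add_closed_scale[OF V jf e] fs[OF jf]) simp
  have "bij_betw (\<lambda>x. x + g) {x \<in> V. f x = 0} {x \<in> V. f x = j}"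
    by (rule bij_betw_byWitness[where f' = "\<lambda>x. x - g"])
       (use V g add_closed_diff[OF V _ g(1)] in \<open>auto simp: f fd add_closed_def\<close>)
  then have "card {x \<in> V. f x = j} = card {x \<in> V. f x = 0}"
    by (rule bij_betw_same_card[symmetric])
  moreover have "card V = p * card {x \<in> V. f x = 0}"
    using bij_betw_same_card[OF bij_betw_split[OF V e f fF fe]]
    by (simp add: card_cartesian_product card_F)
  ultimately show ?thesis by simp
qed

text \<open>One step of diagonalisation. In odd characteristic \<open>polar Q e e = 2 * Q e\<close>
  is nonzero, so \<open>V\<close> is the orthogonal sum of the line through \<open>e\<close> and
  \<open>W\<close>, and \<open>Q\<close> adds up over the summands. The radical survives because it
  is orthogonal to \<open>e\<close> and hence lies in \<open>W\<close>.\<close>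

lemma quad_form_count_step:
  fixes Q :: "'a \<Rightarrow> 'a"
  assumes V: "add_closed V" and Q: "quad_form Q" and e: "e \<in> V" "Q e \<noteq> 0"
  defines "W \<equiv> {x \<in> V. polar Q x e = 0}"
  shows "add_closed W" "card V = p * card W" "radical Q V = radical Q W"
    "j \<in> F \<Longrightarrow> card {x \<in> V. Q x = j} = (\<Sum>t\<in>F. card {x \<in> W. Q x = j - Q e * t\<^sup>2})"
proof -
  have QF: "Q x \<in> F" for x using Q by (simp add: quad_form_def)
  have Qs: "Q (t * x) = t\<^sup>2 * Q x" if "t \<in> F" for t x using Q that by (simp add: quad_form_def)
  have pF: "polar Q x y \<in> F" for x y unfolding polar_def by (intro F_diff QF)
  have padd: "polar Q (x + y) z = polar Q x z + polar Q y z" for x y z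
    using Q by (simp add: quad_form_def)
  have ps: "polar Q (t * x) z = t * polar Q x z" if "t \<in> F" for t x z
    by (rule additive_scale[of "\<lambda>x. polar Q x z"]) (use padd that in auto)
  have padd': "polar Q z (x + y) = polar Q z x + polar Q z y" for x y z
    using padd polar_commute by metis
  have "polar Q e e = 2 * Q e"
    using Qs[of 2 e] by (simp add: polar_def mult_2[symmetric])
  then have pe: "polar Q e e \<noteq> 0" using e two_nonzero by simp
  note bij = bij_betw_split[OF V e(1), of "\<lambda>x. polar Q x e", OF padd pF pe, folded W_def]
  have p0: "polar Q 0 z = 0" for z using ps[of 0] by simp
  show W: "add_closed W" using V by (auto simp: add_closed_def W_def padd p0)
  show "card V = p * card W"
    using bij_betw_same_card[OF bij] by (simp add: card_cartesian_product card_F)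
  show "radical Q V = radical Q W"
  proof (rule set_eqI)
    fix x
    have "polar Q x y = 0" if x: "x \<in> W" "\<forall>y\<in>W. polar Q x y = 0" and y: "y \<in> V" for y
    proof -
      obtain t w where tw: "t \<in> F" "w \<in> W" "y = t * e + w"
        using bij y unfolding bij_betw_def by auto
      then show ?thesis
        using x ps[OF tw(1), of e x] by (simp add: padd' polar_commute[of Q x "t * e"] polar_commute[of Q e x] W_def)
    qed
    then show "x \<in> radical Q V \<longleftrightarrow> x \<in> radical Q W"
      unfolding radical_def using e by (auto simp: W_def)
  qed
  assume j: "j \<in> F"
  have Qsum: "Q (t * e + w) = Q e * t\<^sup>2 + Q w" if "t \<in> F" "w \<in> W" for t w
  proof -
    have "polar Q (t * e) w = 0" using that ps[of t e w] by (simp add: W_def polar_commute[of Q e w])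
    then show ?thesis using Qs[OF that(1), of e] by (simp add: polar_def algebra_simps)
  qed
  have "bij_betw (\<lambda>(t, w). t * e + w) (SIGMA t:F. {x \<in> W. Q x = j - Q e * t\<^sup>2}) {x \<in> V. Q x = j}"
  proof (rule bij_betw_subset[OF bij])
    show "(SIGMA t:F. {x \<in> W. Q x = j - Q e * t\<^sup>2}) \<subseteq> F \<times> W" by auto
    show "(\<lambda>(t, w). t * e + w) ` (SIGMA t:F. {x \<in> W. Q x = j - Q e * t\<^sup>2}) = {x \<in> V. Q x = j}"
    proof safe
      fix t w assume "t \<in> F" "w \<in> W" "Q w = j - Q e * t\<^sup>2"
      then show "t * e + w \<in> V" "Q (t * e + w) = j"
        using bij Qsum[of t w] unfolding bij_betw_def by auto
    next
      fix y assume y: "y \<in> V" "j = Q y"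
      then obtain t w where tw: "t \<in> F" "w \<in> W" "y = t * e + w"
        using bij unfolding bij_betw_def by auto
      then show "y \<in> (\<lambda>(t, w). t * e + w) ` (SIGMA t:F. {x \<in> W. Q x = Q y - Q e * t\<^sup>2})"
        using Qsum[of t w] by (intro image_eqI[of _ _ "(t, w)"]) auto
    qed
  qed
  then show "card {x \<in> V. Q x = j} = (\<Sum>t\<in>F. card {x \<in> W. Q x = j - Q e * t\<^sup>2})"
    using bij_betw_same_card by fastforce
qed

text \<open>The alternatives are rank \<open>2 * i\<close> and rank \<open>2 * i + 1\<close>. Splitting off a vector on which \<open>Q\<close> does
  not vanish leads from one to the other.\<close>
lemma quad_form_count:
  fixes Q :: "'a \<Rightarrow> 'a"
  assumes "add_closed V" and Q: "quad_form Q"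
  defines "D \<equiv> \<lambda>V. int (card (radical Q V))"
  shows "\<exists>i s. s \<in> {1, - 1} \<and>
    ((int (card V) = int p ^ (2 * i) * D V \<and>
      (\<forall>j\<in>F. int (p * card {x \<in> V. Q x = j}) =
         int p ^ (2 * i) * D V + s * int p ^ i * D V * ((if j = 0 then int p else 0) - 1))) \<or>
     (int (card V) = int p ^ (2 * i + 1) * D V \<and>
      (\<forall>j\<in>F. int (p * card {x \<in> V. Q x = j}) =
         int p ^ (2 * i + 1) * D V + s * quad_char j * int p ^ (i + 1) * D V)))"
  using assms(1)
proof (induction "card V" arbitrary: V rule: less_induct)
  case less
  note V = less.prems
  show ?case
  proof (cases "\<forall>x\<in>V. Q x = 0")
    \<comment> \<open>Rank 0: all of \<open>V\<close> is radical, and \<open>i = 0\<close>,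
      \<open>s = 1\<close> fit. The factor \<open>p\<close> on the counts keeps the formula integral
      at \<open>i = 0\<close>.\<close>
    case True
    then have "radical Q V = V"
      using V by (auto simp: radical_def polar_def add_closed_def)
    moreover have "{x \<in> V. Q x = j} = (if j = 0 then V else {})" for j
      using True by auto
    ultimately show ?thesis
      by (intro exI[of _ 0] exI[of _ 1]) (auto simp: D_def algebra_simps)
  next
    case False
    then obtain e where e: "e \<in> V" "Q e \<noteq> 0" by blast
    define W where "W = {x \<in> V. polar Q x e = 0}"
    note st = quad_form_count_step[OF V Q e, folded W_def]
    have QF: "Q e \<in> F" using Q by (simp add: quad_form_def)
    have W0: "card W > 0" using st(1) by (auto simp: card_gt_0_iff add_closed_def)
    have "card W < card V" using st(2) W0 p_ge_3 by simp
    from less.hyps[OF this st(1)] obtain i s where s: "s \<in> {1, - 1}" and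
      alt: "(int (card W) = int p ^ (2 * i) * D W \<and>
      (\<forall>j\<in>F. int (p * card {x \<in> W. Q x = j}) =
         int p ^ (2 * i) * D W + s * int p ^ i * D W * ((if j = 0 then int p else 0) - 1))) \<or>
     (int (card W) = int p ^ (2 * i + 1) * D W \<and>
      (\<forall>j\<in>F. int (p * card {x \<in> W. Q x = j}) =
         int p ^ (2 * i + 1) * D W + s * quad_char j * int p ^ (i + 1) * D W))" by blast
    have D: "D V = D W" using st(3) by (simp add: D_def)
    have cnt: "int (p * card {x \<in> V. Q x = j}) =
        (\<Sum>t\<in>F. int (p * card {x \<in> W. Q x = j - Q e * t\<^sup>2}))" if "j \<in> F" for j
      using st(4)[OF that] by (simp add: sum_distrib_left)
    have jF: "j - Q e * t\<^sup>2 \<in> F" if "j \<in> F" "t \<in> F" for j t using that QF by auto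
    from alt show ?thesis
    proof
      assume A: "int (card W) = int p ^ (2 * i) * D W \<and>
      (\<forall>j\<in>F. int (p * card {x \<in> W. Q x = j}) =
         int p ^ (2 * i) * D W + s * int p ^ i * D W * ((if j = 0 then int p else 0) - 1))"
      have "int (p * card {x \<in> V. Q x = j}) =
         int p ^ (2 * i + 1) * D W + (s * quad_char (Q e)) * quad_char j * int p ^ (i + 1) * D W"
        if j: "j \<in> F" for j
      proof -
        \<comment> \<open>From even to odd rank: the value 0 is hit once for each root
          \<open>t\<close> of \<open>Q e * t\<^sup>2 = j\<close>, and the number of roots brings in
          \<open>quad_char j\<close>.\<close>
        have "(\<Sum>t\<in>F. if j - Q e * t\<^sup>2 = 0 then int p else 0) = int p * int (card {t \<in> F. Q e * t\<^sup>2 = j})"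
          by (simp add: sum.If_cases Int_def eq_commute[of j])
        also have "\<dots> = int p * (1 + quad_char j * quad_char (Q e))"
          using card_scaled_sqrt_F[OF j QF e(2)] by simp
        finally have S: "(\<Sum>t\<in>F. if j - Q e * t\<^sup>2 = 0 then int p else 0) = \<dots>" .
        have "int (p * card {x \<in> V. Q x = j}) = (\<Sum>t\<in>F. int p ^ (2 * i) * D W +
            s * int p ^ i * D W * ((if j - Q e * t\<^sup>2 = 0 then int p else 0) - 1))"
          unfolding cnt[OF j] using A jF[OF j] by (intro sum.cong) auto
        also have "\<dots> = int p * (int p ^ (2 * i) * D W) + s * int p ^ i * D W *
            ((\<Sum>t\<in>F. if j - Q e * t\<^sup>2 = 0 then int p else 0) - int p)"
          by (simp only: sum.distrib sum_distrib_left[symmetric] sum_subtractf) (simp add: card_F)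
        finally show ?thesis unfolding S by (simp add: algebra_simps)
      qed
      moreover have "int (card V) = int p ^ (2 * i + 1) * D W" using A st(2) by simp
      moreover have "s * quad_char (Q e) \<in> {1, - 1}" using s quad_char_cases[OF e(2)] by auto
      ultimately show ?thesis unfolding D by blast
    next
      assume A: "int (card W) = int p ^ (2 * i + 1) * D W \<and>
      (\<forall>j\<in>F. int (p * card {x \<in> W. Q x = j}) =
         int p ^ (2 * i + 1) * D W + s * quad_char j * int p ^ (i + 1) * D W)"
      have "int (p * card {x \<in> V. Q x = j}) = int p ^ (2 * (i + 1)) * D W +
          (s * quad_char (- Q e)) * int p ^ (i + 1) * D W * ((if j = 0 then int p else 0) - 1)"
        if j: "j \<in> F" for j
      proof -
        \<comment> \<open>From odd to even rank: the character is summed along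
          \<open>j - Q e * t\<^sup>2\<close>. That sum depends only on whether \<open>j\<close> is
          0, and the sign picks up \<open>quad_char (- Q e)\<close>.\<close>
        have "int (p * card {x \<in> V. Q x = j}) = (\<Sum>t\<in>F. int p ^ (2 * i + 1) * D W +
            s * int p ^ (i + 1) * D W * quad_char (j - Q e * t\<^sup>2))"
          unfolding cnt[OF j] using A jF[OF j] by (intro sum.cong) auto
        also have "\<dots> = int p * (int p ^ (2 * i + 1) * D W) +
            s * int p ^ (i + 1) * D W * (\<Sum>t\<in>F. quad_char (j - Q e * t\<^sup>2))"
          by (simp only: sum.distrib sum_distrib_left[symmetric]) (simp add: card_F)
        finally show ?thesis
          unfolding sum_quad_char_minus_scaled_square[OF j QF e(2)] by (simp add: algebra_simps)
      qed
      moreover have "int (card V) = int p ^ (2 * (i + 1)) * D W" using A st(2) by simp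
      moreover have "s * quad_char (- Q e) \<in> {1, - 1}" using s quad_char_cases[of "- Q e"] e(2) by auto
      ultimately show ?thesis unfolding D by blast
    qed
  qed
qed

end

section \<open>Double counting, and lists indexed by an interval\<close>

lemma sum_card_swap:
  "(\<Sum>u\<in>UNIV. card {x. R u x}) = (\<Sum>x\<in>UNIV. card {u. R (u :: 'b :: finite) (x :: 'c :: finite)})"
proof -
  have "(\<Sum>u\<in>UNIV. card {x. R u x}) = (\<Sum>u\<in>UNIV. \<Sum>x\<in>UNIV. if R u x then 1 else 0)"
    by (simp add: sum.If_cases)
  also have "\<dots> = (\<Sum>x\<in>UNIV. \<Sum>u\<in>UNIV. if R u x then 1 else 0)" by (rule sum.swap)
  finally show ?thesis by (simp add: sum.If_cases)
qed

lemma card_sum_eq: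
  fixes f :: "'b::finite \<Rightarrow> int" and g :: "'c::finite \<Rightarrow> int"
  assumes "finite E" "range f \<subseteq> E"
  shows "card {(u, v). f u + g v = s} = (\<Sum>e\<in>E. card {u. f u = e} * card {v. g v = s - e})"
proof -
  have "{(u, v). f u + g v = s} = (\<Union>e\<in>E. {u. f u = e} \<times> {v. g v = s - e})"
    using assms(2) by (auto simp: image_subset_iff)
  also have "card \<dots> = (\<Sum>e\<in>E. card ({u. f u = e} \<times> {v. g v = s - e}))"
    by (rule card_UN_disjoint) (use assms(1) in auto)
  finally show ?thesis by (simp add: card_cartesian_product)
qed

lemma card_less_double:
  fixes M :: nat
  shows
  "card {t. t < 2 * M \<and> R t} = card {s. s < M \<and> R (2 * s)} + card {s. s < M \<and> R (2 * s + 1)}"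
proof -
  have "{t. t < 2 * M \<and> R t} = (\<lambda>s. 2 * s) ` {s. s < M \<and> R (2 * s)} \<union> (\<lambda>s. 2 * s + 1) ` {s. s < M \<and> R (2 * s + 1)}"
    (is "?L = ?A \<union> ?B")
  proof
    show "?L \<subseteq> ?A \<union> ?B"
    proof
      fix t assume t: "t \<in> ?L"
      show "t \<in> ?A \<union> ?B"
      proof (cases "even t")
        case True
        then obtain s where "t = 2 * s" by blast
        then show ?thesis using t by auto
      next
        case False
        then obtain s where "t = 2 * s + 1" by (blast elim: oddE)
        then show ?thesis using t by auto
      qed
    qed
  qed auto
  moreover have "?A \<inter> ?B = {}"
  proof -
    have "2 * s \<noteq> 2 * s' + 1" for s s' :: nat by presburger
    then show ?thesis by blast
  qed
  ultimately have "card ?L = card ?A + card ?B" by (simp add: card_Un_disjoint)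
  then show ?thesis by (simp add: card_image inj_on_def)
qed

lemma hamming_weight_map_upt: "hamming_weight (map f [0..<n]) = card {t. t < n \<and> f t \<noteq> 0}"
  unfolding hamming_weight_def length_filter_conv_card
  by (rule arg_cong[where f = card]) auto

text \<open>Rotation puts \<open>f 0\<close> at the end, where the shifted function has
  \<open>f n\<close>.\<close>

lemma rotate1_map_upt:
  assumes "f n = f 0" shows "rotate1 (map f [0..<n]) = map (\<lambda>t. f (Suc t)) [0..<n]"
proof (cases n)
  case (Suc l)
  have "[0..<Suc l] = 0 # map Suc [0..<l]" by (simp add: upt_conv_Cons map_Suc_upt)
  then have "rotate1 (map f [0..<n]) = map (\<lambda>t. f (Suc t)) [0..<l] @ [f 0]"
    unfolding Suc by (simp only: list.map rotate1.simps) (simp add: comp_def)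
  then show ?thesis using assms Suc by simp
qed simp

section \<open>The forms behind the code: radicals and possible numbers of zeros\<close>

locale three_zero_code = odd_degree_field +
  fixes k :: nat
  assumes coprime_mk: "coprime m k" and m_ge_3: "m \<ge> 3"
begin

definition h :: nat where "h = (m - 1) div 2"

definition qf :: "'a \<Rightarrow> 'a \<Rightarrow> 'a \<Rightarrow> 'a" where
  "qf u c x = tr (u * x\<^sup>2 + c * x ^ (p ^ k + 1))"

lemma m_eq: "m = 2 * h + 1"
  using odd_m by (auto simp: h_def elim: oddE)

text \<open>Here coprimality enters: \<open>x\<close> is fixed by the power maps with exponents
  \<open>p ^ k\<close> and \<open>p ^ m\<close>, and a Bezout relation
  \<open>k * a = m * b + 1\<close> combines them to \<open>x ^ p = x\<close>.\<close>

lemma frob_k_fixed: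
  assumes "x ^ (p ^ k) = (x :: 'a)" shows "x \<in> F"
proof -
  obtain a b where ab: "k * a = m * b + 1"
  proof (cases "k = 0")
    \<comment> \<open>\<open>coprime m 0\<close> would mean \<open>m = 1\<close>.\<close>
    case True
    then show ?thesis using coprime_mk m_ge_3 by simp
  next
    case False
    then show ?thesis
      using bezout_nat[of k m] coprime_mk that by (auto simp: coprime_iff_gcd_eq_1 gcd.commute)
  qed
  have "x ^ (p ^ (k * i)) = x" for i
  proof (induction i)
    case (Suc i)
    have "x ^ (p ^ (k * Suc i)) = (x ^ (p ^ (k * i))) ^ (p ^ k)"
      by (simp add: power_add mult.commute flip: power_mult)
    then show ?case using Suc assms by simp
  qed simp
  from this[of a] have "x ^ (p ^ (m * b + 1)) = x" unfolding ab .
  then have "(x ^ (p ^ (m * b))) ^ p = x" by (simp add: mult.commute flip: power_mult)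
  then show ?thesis by (simp add: power_p_pow_mult_m in_F_iff)
qed

text \<open>The inverse of this power map is its iterate of order \<open>m - 1\<close>, since
  \<open>m\<close> iterates give the exponent \<open>p ^ (m * k)\<close>, which fixes every
  element.\<close>

lemma frob_k_surj: "\<exists>y. y ^ (p ^ k) = (x :: 'a)"
proof
  have "k * (m - 1) + k = m * k" using m_ge_3 by (cases m) auto
  then have "(x ^ (p ^ (k * (m - 1)))) ^ (p ^ k) = x ^ (p ^ (m * k))"
    by (metis power_add power_mult)
  then show "(x ^ (p ^ (k * (m - 1)))) ^ (p ^ k) = x" by (simp add: power_p_pow_mult_m)
qed

text \<open>The quotient of two nonzero solutions is fixed by the power map, hence lies in
  \<open>F\<close>: the solutions fill at most one line.\<close>

lemma card_frob_eigen_le: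
  assumes "A \<noteq> 0"
  shows "card {w :: 'a. A * w ^ (p ^ k) = C * w} \<le> p"
proof (cases "\<exists>w0. w0 \<noteq> 0 \<and> A * w0 ^ (p ^ k) = C * w0")
  case True
  then obtain w0 where w0: "w0 \<noteq> 0" "A * w0 ^ (p ^ k) = C * w0" by blast
  have "{w. A * w ^ (p ^ k) = C * w} \<subseteq> (\<lambda>t. t * w0) ` F"
  proof clarify
    fix w assume w: "A * w ^ (p ^ k) = C * w"
    have C: "C \<noteq> 0" using w0 assms by auto
    have "(A * w ^ (p ^ k)) / (A * w0 ^ (p ^ k)) = (C * w) / (C * w0)" using w w0 by simp
    then have "(w / w0) ^ (p ^ k) = w / w0" using assms C by (simp add: power_divide)
    then have "w / w0 \<in> F" by (rule frob_k_fixed)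
    then show "w \<in> (\<lambda>t. t * w0) ` F" using w0 by (intro image_eqI[of _ _ "w / w0"]) auto
  qed
  then have "card {w. A * w ^ (p ^ k) = C * w} \<le> card ((\<lambda>t. t * w0) ` F)"
    by (rule card_mono[rotated]) simp
  also have "\<dots> \<le> p" using card_image_le[of F "\<lambda>t. t * w0"] by (simp add: card_F)
  finally show ?thesis .
next
  case False
  then have "{w. A * w ^ (p ^ k) = C * w} \<subseteq> {0}" by auto
  then have "card {w. A * w ^ (p ^ k) = C * w} \<le> card {0::'a}" by (rule card_mono[rotated]) simp
  then show ?thesis using p_ge_3 by simp
qed

text \<open>Reduction of order, as for a linear differential equation: with a solution
  \<open>x0\<close> at hand, \<open>x = x0 * z\<close> turns the equation into one of first order
  for \<open>w = z ^ (p ^ k) - z\<close>. There are at most \<open>p\<close> such \<open>w\<close>,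
  and at most \<open>p\<close> values \<open>z\<close> for each.\<close>

lemma card_frob_quadratic_le:
  assumes A: "A \<noteq> 0"
  shows "card {x :: 'a. A * (x ^ (p ^ k)) ^ (p ^ k) + B * x ^ (p ^ k) + C * x = 0} \<le> p\<^sup>2"
    (is "card ?K \<le> _")
proof (cases "?K \<subseteq> {0}")
  case True
  then have "card ?K \<le> card {0::'a}" by (rule card_mono[rotated]) simp
  also have "\<dots> \<le> p\<^sup>2" using p_ge_3 by simp
  finally show ?thesis .
next
  case False
  let ?s = "\<lambda>x :: 'a. x ^ (p ^ k)"
  from False obtain x0 where x0: "x0 \<noteq> 0" "A * ?s (?s x0) + B * ?s x0 + C * x0 = 0" by blast
  define A' B' C' where "A' = A * ?s (?s x0)" and "B' = B * ?s x0" and "C' = C * x0"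
  have A': "A' \<noteq> 0" using A x0 by (simp add: A'_def)
  \<comment> \<open>This says that \<open>z = 1\<close> solves the transformed equation.\<close>
  have B': "B' = - A' - C'" using x0(2) unfolding A'_def[symmetric] B'_def[symmetric] C'_def[symmetric]
    by (simp add: algebra_simps eq_neg_iff_add_eq_0)
  define W where "W = {w. A' * ?s w = C' * w}"
  \<comment> \<open>Two solutions \<open>z\<close> differ by a fixed point of the power map, that
    is, by an element of \<open>F\<close>.\<close>
  have fib: "card {z. ?s z - z = w} \<le> p" for w
  proof (cases "\<exists>z0. ?s z0 - z0 = w")
    case True
    then obtain z0 where z0: "?s z0 - z0 = w" by blast
    have "{z. ?s z - z = w} \<subseteq> (\<lambda>t. t + z0) ` F"
    proof clarify
      fix z assume "w = ?s z - z"
      then have "?s (z - z0) = z - z0" using z0 by (simp add: frob_diff algebra_simps)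
      then have "z - z0 \<in> F" by (rule frob_k_fixed)
      then show "z \<in> (\<lambda>t. t + z0) ` F" by (intro image_eqI[of _ _ "z - z0"]) auto
    qed
    then have "card {z. ?s z - z = w} \<le> card ((\<lambda>t. t + z0) ` F)"
      by (rule card_mono[rotated]) simp
    also have "\<dots> \<le> p" using card_image_le[of F "\<lambda>t. t + z0"] by (simp add: card_F)
    finally show ?thesis .
  qed simp
  have "?K \<subseteq> (\<lambda>z. x0 * z) ` (\<Union>w\<in>W. {z. ?s z - z = w})"
  proof clarify
    fix x assume x: "A * ?s (?s x) + B * ?s x + C * x = 0"
    define z where "z = x / x0"
    have xz: "x = x0 * z" using x0 by (simp add: z_def)
    have "A' * ?s (?s z) + B' * ?s z + C' * z = 0"
      using x unfolding xz A'_def B'_def C'_def by (simp add: power_mult_distrib mult_ac)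
    then have "A' * ?s (?s z - z) = C' * (?s z - z)"
      unfolding B' by (simp add: frob_diff algebra_simps)
    then have "?s z - z \<in> W" by (simp add: W_def)
    then show "x \<in> (\<lambda>z. x0 * z) ` (\<Union>w\<in>W. {z. ?s z - z = w})"
      unfolding xz by blast
  qed
  then have "card ?K \<le> card ((\<lambda>z. x0 * z) ` (\<Union>w\<in>W. {z. ?s z - z = w}))"
    by (rule card_mono[rotated]) simp
  also have "\<dots> \<le> card (\<Union>w\<in>W. {z. ?s z - z = w})" by (rule card_image_le) simp
  also have "\<dots> \<le> (\<Sum>w\<in>W. card {z. ?s z - z = w})" by (rule card_UN_le) simp
  also have "\<dots> \<le> (\<Sum>w\<in>W. p)" by (rule sum_mono) (rule fib)
  also have "\<dots> = card W * p" by simp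
  also have "\<dots> \<le> p * p" using card_frob_eigen_le[OF A'] unfolding W_def by (rule mult_right_mono) simp
  finally show ?thesis by (simp add: power2_eq_square)
qed

lemma polar_qf:
  "polar (qf u c) x y = tr ((2 * u * x + c * x ^ (p ^ k)) * y + c * x * y ^ (p ^ k))"
  unfolding polar_def qf_def tr_diff[symmetric]
  by (rule arg_cong[where f = tr]) (simp add: frob_add power2_eq_square algebra_simps)

lemma qf_minus: "qf u c (- x) = qf u c x"
  using odd_p by (simp add: qf_def)

lemma qf_scale: "t \<in> F \<Longrightarrow> qf u c (t * x) = t\<^sup>2 * qf u c x"
proof -
  assume t: "t \<in> F"
  have "u * (t * x)\<^sup>2 + c * (t * x) ^ (p ^ k + 1) = t\<^sup>2 * (u * x\<^sup>2 + c * x ^ (p ^ k + 1))"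
    using F_frob[OF t, of k] by (simp add: power_mult_distrib power2_eq_square algebra_simps)
  then show ?thesis unfolding qf_def using tr_scale[of "t\<^sup>2"] t by (auto simp del: power_Suc)
qed

lemma quad_form_qf: "quad_form (qf u c)"
proof -
  have "polar (qf u c) (x + y) z = polar (qf u c) x z + polar (qf u c) y z" for x y z
    unfolding polar_qf tr_add[symmetric]
    by (rule arg_cong[where f = tr]) (simp add: frob_add algebra_simps)
  then show ?thesis
    unfolding quad_form_def using qf_scale by (auto simp: qf_def)
qed

text \<open>Raising the argument of the trace to the power \<open>p ^ k\<close> leaves the trace
  unchanged and turns the factor \<open>y\<close> into \<open>y ^ (p ^ k)\<close>, which is
  arbitrary. Nondegeneracy then gives an equation of second order for \<open>x\<close>, with leading
  coefficient \<open>c ^ (p ^ k)\<close>.\<close>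

lemma card_radical_qf_le:
  assumes "c \<noteq> 0"
  shows "card (radical (qf u c) UNIV) \<le> p\<^sup>2"
proof -
  let ?s = "\<lambda>x :: 'a. x ^ (p ^ k)"
  have "radical (qf u c) UNIV \<subseteq> {x. ?s c * ?s (?s x) + ?s (2 * u) * ?s x + c * x = 0}"
  proof
    fix x assume x: "x \<in> radical (qf u c) UNIV"
    let ?A = "2 * u * x + c * ?s x"
    have "tr (w * (?s ?A + c * x)) = 0" for w
    proof -
      obtain y where y: "w = ?s y" using frob_k_surj by metis
      have "?s y * (?s ?A + c * x) = ?s (?A * y) + c * x * ?s y"
        unfolding power_mult_distrib[of ?A y] by (simp only: distrib_left mult_ac)
      then have "tr (w * (?s ?A + c * x)) = tr (?s (?A * y)) + tr (c * x * ?s y)"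
        unfolding tr_add[symmetric] y by (rule arg_cong)
      also have "\<dots> = polar (qf u c) x y" unfolding polar_qf tr_frob tr_add ..
      finally show ?thesis using x by (simp add: radical_def)
    qed
    then have "?s ?A + c * x = 0" by (rule tr_nondegenerate)
    then show "x \<in> {x. ?s c * ?s (?s x) + ?s (2 * u) * ?s x + c * x = 0}"
      by (simp add: frob_add power_mult_distrib algebra_simps)
  qed
  then have "card (radical (qf u c) UNIV) \<le> card {x. ?s c * ?s (?s x) + ?s (2 * u) * ?s x + c * x = 0}"
    by (rule card_mono[rotated]) simp
  also have "\<dots> \<le> p\<^sup>2" by (rule card_frob_quadratic_le) (use assms in simp)
  finally show ?thesis .
qed

lemma radical_qf_0:
  assumes "u \<noteq> 0" shows "radical (qf u 0) UNIV = {0}"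
proof -
  have "x = 0" if "x \<in> radical (qf u 0) UNIV" for x
  proof -
    have "tr (w * (2 * u * x)) = polar (qf u 0) x w" for w
      by (simp add: polar_qf mult_ac)
    then have "tr (w * (2 * u * x)) = 0" for w
      using that by (simp add: radical_def)
    then have "2 * u * x = 0" by (rule tr_nondegenerate)
    then show ?thesis using assms two_nonzero by simp
  qed
  moreover have "0 \<in> radical (qf u 0) UNIV" by (simp add: radical_def polar_qf)
  ultimately show ?thesis by auto
qed

definition zeros :: "'a \<Rightarrow> 'a \<Rightarrow> nat" where
  "zeros u c = card {x. qf u c x = 0}"

text \<open>In odd rank the deviation carries the factor \<open>quad_char 0 = 0\<close>, which is
  the first alternative; only even rank \<open>2 * i\<close> leaves a sign.\<close>

lemma zeros_cases:
  "zeros u c = p ^ (m - 1) \<or>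
   (\<exists>i. p ^ (2 * i) * card (radical (qf u c) UNIV) = p ^ m \<and>
     (\<exists>s\<in>{1, - 1}. int p * int (zeros u c) = int p ^ m +
        s * int p ^ i * int (card (radical (qf u c) UNIV)) * (int p - 1)))"
proof -
  let ?D = "card (radical (qf u c) UNIV)"
  have V: "add_closed (UNIV :: 'a set)" by (simp add: add_closed_def)
  obtain i s where s: "s \<in> {1, - 1 :: int}" and
    alt: "(int (card (UNIV :: 'a set)) = int p ^ (2 * i) * int ?D \<and>
      (\<forall>j\<in>F. int (p * card {x \<in> UNIV. qf u c x = j}) =
         int p ^ (2 * i) * int ?D + s * int p ^ i * int ?D * ((if j = 0 then int p else 0) - 1))) \<or>
     (int (card (UNIV :: 'a set)) = int p ^ (2 * i + 1) * int ?D \<and>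
      (\<forall>j\<in>F. int (p * card {x \<in> UNIV. qf u c x = j}) =
         int p ^ (2 * i + 1) * int ?D + s * quad_char j * int p ^ (i + 1) * int ?D))"
    using quad_form_count[OF V quad_form_qf[of u c]] by blast
  from alt show ?thesis
  proof
    assume A: "int (card (UNIV :: 'a set)) = int p ^ (2 * i) * int ?D \<and>
      (\<forall>j\<in>F. int (p * card {x \<in> UNIV. qf u c x = j}) =
         int p ^ (2 * i) * int ?D + s * int p ^ i * int ?D * ((if j = 0 then int p else 0) - 1))"
    then have "int (p ^ (2 * i) * ?D) = int (p ^ m)" by (simp add: card_UNIV)
    moreover have "int p * int (zeros u c) = int p ^ m + s * int p ^ i * int ?D * (int p - 1)"
      using A[THEN conjunct2, rule_format, of 0] A[THEN conjunct1] by (simp add: zeros_def card_UNIV)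
    ultimately show ?thesis using s by (metis of_nat_eq_iff)
  next
    assume A: "int (card (UNIV :: 'a set)) = int p ^ (2 * i + 1) * int ?D \<and>
      (\<forall>j\<in>F. int (p * card {x \<in> UNIV. qf u c x = j}) =
         int p ^ (2 * i + 1) * int ?D + s * quad_char j * int p ^ (i + 1) * int ?D)"
    then have "int (p * zeros u c) = int (p ^ m)"
      using A[THEN conjunct2, rule_format, of 0] by (simp add: zeros_def card_UNIV)
    then have "p * zeros u c = p * p ^ (m - 1)"
      unfolding of_nat_eq_iff using m_ge_3 by (simp add: power_eq_if)
    then show ?thesis using p_ge_3 by simp
  qed
qed

text \<open>For even rank the radical has \<open>p ^ d\<close> elements with
  \<open>2 * i + d = m\<close> and \<open>d \<le> 2\<close>. As \<open>m\<close> is odd,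
  \<open>d = 1\<close> and \<open>i = h\<close>.\<close>

lemma zeros_values:
  assumes "c \<noteq> 0"
  shows "\<exists>e\<in>{- 1, 0, 1}. int (zeros u c) = int p ^ (m - 1) + e * (int p - 1) * int p ^ h"
proof -
  let ?D = "card (radical (qf u c) UNIV)"
  from zeros_cases[of u c] show ?thesis
  proof
    assume "\<exists>i. p ^ (2 * i) * ?D = p ^ m \<and>
     (\<exists>s\<in>{1, - 1}. int p * int (zeros u c) = int p ^ m + s * int p ^ i * int ?D * (int p - 1))"
    then obtain i s where i: "p ^ (2 * i) * ?D = p ^ m" and s: "s \<in> {1, - 1}"
      "int p * int (zeros u c) = int p ^ m + s * int p ^ i * int ?D * (int p - 1)" by blast
    have "?D dvd p ^ m" using i by (metis dvd_triv_right)
    then obtain d where d: "?D = p ^ d" using divides_primepow_nat[OF prime_p] by blast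
    have "p ^ d \<le> p ^ 2" using card_radical_qf_le[OF assms, of u] d by simp
    then have "d \<le> 2" using p_ge_3 by (simp add: power_le_imp_le_exp)
    moreover have "p ^ (2 * i + d) = p ^ m" using i d by (simp add: power_add)
    then have "2 * i + d = m" using p_ge_3 by simp
    ultimately have "d = 1" "i = h" using m_eq by presburger+
    moreover have "int p ^ m = int p * int p ^ (m - 1)" using m_ge_3 by (simp add: power_eq_if)
    ultimately have "int p * int (zeros u c) = int p * (int p ^ (m - 1) + s * (int p - 1) * int p ^ h)"
      using s(2) d by (simp add: algebra_simps)
    then have "int (zeros u c) = int p ^ (m - 1) + s * (int p - 1) * int p ^ h"
      using p_ge_3 by simp
    then show ?thesis using s(1) by blast
  qed auto
qed

text \<open>The radical is trivial, so even rank would make \<open>m\<close> even.\<close>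

lemma zeros_0:
  assumes "u \<noteq> 0" shows "zeros u 0 = p ^ (m - 1)"
proof -
  have "p ^ (2 * i) \<noteq> p ^ m" for i
    using p_ge_3 odd_m by auto
  then show ?thesis using zeros_cases[of u 0] radical_qf_0[OF assms] by auto
qed

lemma zeros_0_0: "zeros 0 0 = p ^ m"
  by (simp add: zeros_def qf_def card_UNIV)

lemma card_tr_eq:
  assumes "z \<noteq> 0" "j \<in> F"
  shows "card {u. tr (u * z) = j} = p ^ (m - 1)"
proof -
  obtain e where "tr (e * z) \<noteq> 0" using tr_nondegenerate assms by blast
  then have "p * card {u \<in> UNIV. tr (u * z) = j} = card (UNIV :: 'a set)"
    by (intro card_additive_fibre[where e = e])
       (auto simp: add_closed_def assms distrib_right tr_add)
  also have "\<dots> = p * p ^ (m - 1)" using m_ge_3 by (simp add: card_UNIV power_eq_if)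
  finally show ?thesis using p_ge_3 by simp
qed

text \<open>Two independent linear conditions on \<open>u\<close>. If the first functional vanished
  on the kernel \<open>K\<close> of the second, it would be \<open>t\<close> times the second, with
  \<open>t\<close> read off at \<open>e\<close>, and \<open>z1 = t * z2\<close> would
  follow.\<close>

lemma card_tr_eq2:
  assumes z: "z2 \<noteq> 0" "\<And>t. t \<in> F \<Longrightarrow> z1 \<noteq> t * z2" and ij: "i \<in> F" "j \<in> F"
  shows "card {u. tr (u * z1) = i \<and> tr (u * z2) = j} = p ^ (m - 2)"
proof -
  define K where "K = {u. tr (u * z2) = 0}"
  obtain e where e0: "tr (e * z2) \<noteq> 0" using tr_nondegenerate z(1) by blast
  have "\<exists>u\<in>K. tr (u * z1) \<noteq> 0"
  proof (rule ccontr)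
    assume *: "\<not> ?thesis"
    define t where "t = tr (e * z1) / tr (e * z2)"
    have tF: "t \<in> F" by (auto simp: t_def)
    have "tr (u * (z1 - t * z2)) = 0" for u
    proof -
      define l where "l = tr (u * z2) / tr (e * z2)"
      have lF: "l \<in> F" by (auto simp: l_def)
      have "tr ((u - l * e) * z2) = 0"
        using tr_scale[OF lF, of "e * z2"] e0 by (simp add: left_diff_distrib tr_diff mult.assoc l_def)
      then have "tr ((u - l * e) * z1) = 0" using * by (auto simp: K_def)
      then have "tr (u * z1) = l * tr (e * z1)"
        using tr_scale[OF lF, of "e * z1"] by (simp add: left_diff_distrib tr_diff mult.assoc)
      moreover have "tr (u * (t * z2)) = t * tr (u * z2)"
        using tr_scale[OF tF, of "u * z2"] by (simp add: mult_ac)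
      ultimately show ?thesis by (simp add: right_diff_distrib tr_diff t_def l_def)
    qed
    then have "z1 - t * z2 = 0" by (rule tr_nondegenerate)
    then show False using z(2)[OF tF] by simp
  qed
  then obtain e1 where e1: "e1 \<in> K" "tr (e1 * z1) \<noteq> 0" by blast
  \<comment> \<open>Translation by \<open>u0\<close> moves \<open>K\<close> onto the solutions of
    \<open>tr (u * z2) = j\<close>.\<close>
  define u0 where "u0 = j / tr (e * z2) * e"
  have u0: "tr (u0 * z2) = j"
    using tr_scale[of "j / tr (e * z2)" "e * z2"] e0 ij by (simp add: u0_def F_divide mult_ac)
  have K: "add_closed K" by (auto simp: K_def add_closed_def distrib_right tr_add)
  have cK: "card K = p * p ^ (m - 2)"
  proof -
    have "card K = p ^ (m - 1)" unfolding K_def by (rule card_tr_eq) (use z in auto)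
    also have "m - 1 = Suc (m - 2)" using m_ge_3 by simp
    finally show ?thesis by simp
  qed
  have "p * card {u \<in> K. tr (u * z1) = i - tr (u0 * z1)} = card K"
    by (rule card_additive_fibre[OF K e1(1)]) (use e1 ij in \<open>auto simp: distrib_right tr_add\<close>)
  then have "card {u \<in> K. tr (u * z1) = i - tr (u0 * z1)} = p ^ (m - 2)"
    using cK p_ge_3 by simp
  moreover have "bij_betw (\<lambda>u. u + u0) {u \<in> K. tr (u * z1) = i - tr (u0 * z1)}
      {u. tr (u * z1) = i \<and> tr (u * z2) = j}"
    by (rule bij_betw_byWitness[where f' = "\<lambda>u. u - u0"])
       (auto simp: K_def distrib_right left_diff_distrib tr_add tr_diff u0)
  then have "card {u \<in> K. tr (u * z1) = i - tr (u0 * z1)} = card {u. tr (u * z1) = i \<and> tr (u * z2) = j}"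
    by (rule bij_betw_same_card)
  ultimately show ?thesis by simp
qed

subsection \<open>Moments of the number of zeros\<close>

lemma pow_m_eq: "int p ^ m = int p * int p ^ (m - 1)"
  using m_ge_3 by (simp add: power_eq_if)

lemma pow_h_square: "int p ^ h * int p ^ h = int p ^ (m - 1)"
proof -
  have "m - 1 = h + h" using m_eq by simp
  then show ?thesis by (simp only: power_add)
qed

lemma qf_split: "qf u c x = tr (u * x\<^sup>2) + qf 0 c x"
  by (simp add: qf_def tr_add)

lemma qf_in_F [simp, intro]: "qf u c x \<in> F"
  by (simp add: qf_def)

lemma qf_eq_0_iff: "qf u c x = 0 \<longleftrightarrow> tr (u * x\<^sup>2) = - qf 0 c x"
  unfolding qf_split[of u c x] by (simp add: eq_neg_iff_add_eq_0)

lemma card_qf_eq_0: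
  assumes "x \<noteq> 0" shows "card {u. qf u c x = 0} = p ^ (m - 1)"
  unfolding qf_eq_0_iff by (rule card_tr_eq) (use assms in auto)

lemma qf_at_0 [simp]: "qf u c 0 = 0"
  by (simp add: qf_def)

text \<open>For fixed \<open>x\<close> the condition is linear in \<open>u\<close>: void for
  \<open>x = 0\<close>, and met by \<open>p ^ (m - 1)\<close> values otherwise.\<close>

lemma sum_zeros: "(\<Sum>u\<in>UNIV. zeros u c) = p ^ m + (p ^ m - 1) * p ^ (m - 1)"
proof -
  have "(\<Sum>u\<in>UNIV. zeros u c) = (\<Sum>x\<in>UNIV. card {u. qf u c x = 0})"
    unfolding zeros_def by (rule sum_card_swap)
  also have "\<dots> = card {u. qf u c 0 = 0} + (\<Sum>x\<in>UNIV - {0}. card {u. qf u c x = 0})"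
    by (rule sum.remove) auto
  also have "(\<Sum>x\<in>UNIV - {0}. card {u. qf u c x = 0}) = (\<Sum>x\<in>UNIV - {0::'a}. p ^ (m - 1))"
    by (rule sum.cong) (auto simp: card_qf_eq_0)
  finally show ?thesis by (simp add: card_UNIV card_Diff_subset)
qed

text \<open>A \<open>y\<close> on the line through \<open>x\<close> adds no condition on
  \<open>u\<close>. For any other \<open>y\<close> the squares of \<open>x\<close> and
  \<open>y\<close> are independent over \<open>F\<close>, by \<open>F_sqrt\<close>, and
  \<open>card_tr_eq2\<close> applies.\<close>

lemma sum_card_common_zeros:
  assumes "x \<noteq> 0"
  shows "(\<Sum>y\<in>UNIV. card {u. qf u c x = 0 \<and> qf u c y = 0}) = p ^ m + (p ^ m - p) * p ^ (m - 2)"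
proof -
  let ?L = "(\<lambda>t. t * x) ` F"
  have cL: "card ?L = p"
    by (subst card_image) (use assms in \<open>auto simp: inj_on_def card_F\<close>)
  have "(\<Sum>y\<in>UNIV. card {u. qf u c x = 0 \<and> qf u c y = 0}) =
      (\<Sum>y\<in>UNIV - ?L. card {u. qf u c x = 0 \<and> qf u c y = 0}) + (\<Sum>y\<in>?L. card {u. qf u c x = 0 \<and> qf u c y = 0})"
    by (rule sum.subset_diff) auto
  also have "(\<Sum>y\<in>?L. card {u. qf u c x = 0 \<and> qf u c y = 0}) = (\<Sum>y\<in>?L. p ^ (m - 1))"
  proof (rule sum.cong)
    fix y assume "y \<in> ?L"
    then obtain t where "t \<in> F" "y = t * x" by blast
    then have "{u. qf u c x = 0 \<and> qf u c y = 0} = {u. qf u c x = 0}"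
      by (auto simp: qf_scale)
    then show "card {u. qf u c x = 0 \<and> qf u c y = 0} = p ^ (m - 1)"
      using card_qf_eq_0[OF assms] by simp
  qed simp
  also have "\<dots> = p ^ m" using cL m_ge_3 by (simp add: power_eq_if)
  also have "(\<Sum>y\<in>UNIV - ?L. card {u. qf u c x = 0 \<and> qf u c y = 0}) = (\<Sum>y\<in>UNIV - ?L. p ^ (m - 2))"
  proof (rule sum.cong)
    fix y assume y: "y \<in> UNIV - ?L"
    have y0: "y \<noteq> 0" using y by force
    have ind: "x\<^sup>2 \<noteq> t * y\<^sup>2" if "t \<in> F" for t
    proof
      assume "x\<^sup>2 = t * y\<^sup>2"
      then have "(x / y)\<^sup>2 = t" using y0 by (simp add: power_divide)
      then have "x / y \<in> F" using F_sqrt that by blast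
      then have "1 / (x / y) \<in> F" by (rule F_divide[OF F_1])
      then have "y / x \<in> F" by simp
      then have "y / x * x \<in> ?L" by (rule imageI)
      then show False using assms y by simp
    qed
    show "card {u. qf u c x = 0 \<and> qf u c y = 0} = p ^ (m - 2)"
      unfolding qf_eq_0_iff by (rule card_tr_eq2) (use y0 ind in auto)
  qed simp
  also have "\<dots> = (p ^ m - p) * p ^ (m - 2)"
    using cL by (simp add: card_UNIV card_Diff_subset)
  finally show ?thesis by simp
qed

text \<open>The square counts pairs of zeros of the same form; pairs with \<open>x = 0\<close> give
  the first moment again.\<close>

lemma sum_zeros_square:
  "(\<Sum>u\<in>UNIV. (zeros u c)\<^sup>2) = p ^ m + (p ^ m - 1) * p ^ (m - 1)
     + (p ^ m - 1) * (p ^ m + (p ^ m - p) * p ^ (m - 2))"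
proof -
  have "(\<Sum>u\<in>UNIV. (zeros u c)\<^sup>2) = (\<Sum>u\<in>UNIV. card {z. qf u c (fst z) = 0 \<and> qf u c (snd z) = 0})"
  proof (rule sum.cong)
    fix u
    have "{z. qf u c (fst z) = 0 \<and> qf u c (snd z) = 0} = {x. qf u c x = 0} \<times> {x. qf u c x = 0}" by auto
    then show "(zeros u c)\<^sup>2 = card {z. qf u c (fst z) = 0 \<and> qf u c (snd z) = 0}"
      by (simp add: zeros_def card_cartesian_product power2_eq_square)
  qed simp
  also have "\<dots> = (\<Sum>z\<in>UNIV. card {u. qf u c (fst z) = 0 \<and> qf u c (snd z) = 0})"
    by (rule sum_card_swap)
  also have "\<dots> = (\<Sum>x\<in>UNIV. \<Sum>y\<in>UNIV. card {u. qf u c x = 0 \<and> qf u c y = 0})"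
    by (simp add: sum.cartesian_product case_prod_beta)
  also have "\<dots> = (\<Sum>y\<in>UNIV. card {u. qf u c 0 = 0 \<and> qf u c y = 0}) +
      (\<Sum>x\<in>UNIV - {0}. \<Sum>y\<in>UNIV. card {u. qf u c x = 0 \<and> qf u c y = 0})"
    by (rule sum.remove) auto
  also have "(\<Sum>y\<in>UNIV. card {u. qf u c 0 = 0 \<and> qf u c y = 0}) = (\<Sum>u\<in>UNIV. zeros u c)"
    unfolding zeros_def by (simp add: sum_card_swap[of "\<lambda>u x. qf u c x = 0"])
  also have "(\<Sum>x\<in>UNIV - {0}. \<Sum>y\<in>UNIV. card {u. qf u c x = 0 \<and> qf u c y = 0}) =
      (\<Sum>x\<in>UNIV - {0::'a}. p ^ m + (p ^ m - p) * p ^ (m - 2))"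
    by (rule sum.cong) (auto simp: sum_card_common_zeros)
  finally show ?thesis
    unfolding sum_zeros by (simp add: card_UNIV card_Diff_subset)
qed

text \<open>Zero for a form of odd rank and a sign for a form of rank \<open>m - 1\<close>. The zero form gets the value
  \<open>p ^ h\<close>, so that \<open>zeros_eq_eps\<close> holds without exception.\<close>
definition eps :: "'a \<Rightarrow> 'a \<Rightarrow> int" where
  "eps u c = (int (zeros u c) - int p ^ (m - 1)) div ((int p - 1) * int p ^ h)"

lemma eps_eqI:
  assumes "int (zeros u c) = int p ^ (m - 1) + e * (int p - 1) * int p ^ h"
  shows "eps u c = e"
proof -
  have "(int p - 1) * int p ^ h \<noteq> 0" using p_ge_3 by simp
  then show ?thesis unfolding eps_def assms by simp
qed

lemma eps_0: "eps u 0 = (if u = 0 then int p ^ h else 0)"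
  by (rule eps_eqI)
     (auto simp: zeros_0 zeros_0_0 pow_m_eq pow_h_square[symmetric] algebra_simps simp del: One_nat_def)

lemma eps_range: "c \<noteq> 0 \<Longrightarrow> eps u c \<in> {- 1, 0, 1}"
  using zeros_values[of c u] eps_eqI by metis

lemma zeros_eq_eps: "int (zeros u c) = int p ^ (m - 1) + eps u c * (int p - 1) * int p ^ h"
proof (cases "c = 0")
  case True
  then show ?thesis
    by (auto simp: eps_0 zeros_0 zeros_0_0 pow_m_eq pow_h_square[symmetric] algebra_simps simp del: One_nat_def)
next
  case False
  then show ?thesis using zeros_values[of c u] eps_eqI by metis
qed

text \<open>Both moments of \<open>zeros\<close> are rewritten through \<open>zeros_eq_eps\<close>.
  As \<open>p ^ (m - 1)\<close> is the square of \<open>p ^ h\<close>, common factors cancel and the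
  result is free of \<open>c\<close>.\<close>

lemma sum_eps:
  assumes "c \<noteq> 0"
  shows "(\<Sum>u\<in>UNIV. eps u c) = int p ^ h" "(\<Sum>u\<in>UNIV. (eps u c)\<^sup>2) = int p ^ (m - 1)"
proof -
  define P where "P = int p ^ (m - 1)"
  define H where "H = int p ^ h"
  have PH: "P = H * H" using pow_h_square by (simp add: P_def H_def)
  have pm: "int p ^ m = int p * P" unfolding P_def by (rule pow_m_eq)
  have pm2: "int p * int p ^ (m - 2) = P"
    unfolding P_def using m_ge_3 by (subst power_Suc[symmetric]) (simp add: Suc_diff_Suc numeral_2_eq_2)
  have H0: "H \<noteq> 0" "P \<noteq> 0" "int p - 1 \<noteq> 0" using p_ge_3 by (auto simp: H_def P_def)
  have z: "int (zeros u c) = P + (int p - 1) * H * eps u c" for u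
    using zeros_eq_eps[of u c] by (simp add: P_def H_def)
  have n1: "int (p ^ m - 1) = int p * P - 1"
    using p_pow_m_ge by (simp add: of_nat_diff pm)
  have n2: "int (p ^ m - p) = int p * P - int p"
    using self_le_power[of p m] p_ge_3 m_ge_3 by (simp add: of_nat_diff pm)
  have "int (\<Sum>u\<in>UNIV. zeros u c) = int p * P + (int p * P - 1) * P"
    unfolding sum_zeros of_nat_add of_nat_mult n1 by (simp add: pm P_def[symmetric] del: One_nat_def)
  moreover have "int (\<Sum>u\<in>UNIV. zeros u c) = int p * P * P + (int p - 1) * H * (\<Sum>u\<in>UNIV. eps u c)"
    by (simp add: z sum.distrib sum_distrib_left[symmetric] card_UNIV pm)
  ultimately have "(int p - 1) * H * (\<Sum>u\<in>UNIV. eps u c) = (int p - 1) * H * H"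
    by (simp add: PH algebra_simps)
  then have s1: "(\<Sum>u\<in>UNIV. eps u c) = H" using H0 by simp
  have "int (\<Sum>u\<in>UNIV. (zeros u c)\<^sup>2) = int p * P + (int p * P - 1) * P
     + (int p * P - 1) * (int p * P + (P - 1) * P)"
  proof -
    have "(int p * P - int p) * int p ^ (m - 2) = (P - 1) * P"
      using pm2 by (simp add: algebra_simps)
    then show ?thesis
      unfolding sum_zeros_square of_nat_add of_nat_mult n1 n2 by (simp add: pm P_def[symmetric] del: One_nat_def)
  qed
  moreover have "int (\<Sum>u\<in>UNIV. (zeros u c)\<^sup>2) = int p * P * (P * P) +
      2 * P * ((int p - 1) * H) * (\<Sum>u\<in>UNIV. eps u c) + ((int p - 1) * H)\<^sup>2 * (\<Sum>u\<in>UNIV. (eps u c)\<^sup>2)"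
  proof -
    have "int (\<Sum>u\<in>UNIV. (zeros u c)\<^sup>2) = (\<Sum>u\<in>UNIV. P * P + 2 * P * ((int p - 1) * H) * eps u c
        + ((int p - 1) * H)\<^sup>2 * (eps u c)\<^sup>2)"
      unfolding of_nat_sum of_nat_power z by (rule sum.cong) (auto simp: power2_eq_square algebra_simps)
    also have "\<dots> = int p * P * (P * P) +
      2 * P * ((int p - 1) * H) * (\<Sum>u\<in>UNIV. eps u c) + ((int p - 1) * H)\<^sup>2 * (\<Sum>u\<in>UNIV. (eps u c)\<^sup>2)"
      by (simp only: sum.distrib sum_distrib_left[symmetric]) (simp add: card_UNIV pm)
    finally show ?thesis .
  qed
  ultimately have "((int p - 1) * H)\<^sup>2 * (\<Sum>u\<in>UNIV. (eps u c)\<^sup>2) = ((int p - 1) * H)\<^sup>2 * P"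
    unfolding s1 PH by (simp add: algebra_simps power2_eq_square)
  then show "(\<Sum>u\<in>UNIV. (eps u c)\<^sup>2) = int p ^ (m - 1)" using H0 by (simp add: P_def)
  show "(\<Sum>u\<in>UNIV. eps u c) = int p ^ h" using s1 by (simp add: H_def)
qed

text \<open>The solution of the linear system formed by the total \<open>p ^ m\<close> and the two
  sums of \<open>sum_eps\<close>.\<close>

definition eps_count :: "int \<Rightarrow> real" where
  "eps_count e = (if e = 1 then (real p ^ (m - 1) + real p ^ h) / 2
     else if e = - 1 then (real p ^ (m - 1) - real p ^ h) / 2
     else if e = 0 then real p ^ m - real p ^ (m - 1) else 0)"

lemma card_eps:
  assumes c: "c \<noteq> 0"
  shows "real (card {u. eps u c = e}) = eps_count e"
proof -
  define n where "n e = int (card {u. eps u c = e})" for e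
  have S: "(\<Sum>u\<in>UNIV. f (eps u c)) = f (- 1) * n (- 1) + f 0 * n 0 + f 1 * n 1" for f :: "int \<Rightarrow> int"
  proof -
    have "(\<Sum>u\<in>UNIV. f (eps u c)) = (\<Sum>e\<in>{- 1, 0, 1}. \<Sum>u\<in>{u\<in>UNIV. eps u c = e}. f (eps u c))"
      by (rule sum.group[symmetric]) (use eps_range[OF c] in auto)
    then show ?thesis by (simp add: n_def algebra_simps)
  qed
  \<comment> \<open>The moments of order 0, 1 and 2.\<close>
  have "int p ^ m = n (- 1) + n 0 + n 1" using S[of "\<lambda>_. 1"] by (simp add: card_UNIV)
  moreover have "int p ^ h = n 1 - n (- 1)" using S[of "\<lambda>e. e"] sum_eps(1)[OF c] by simp
  moreover have "int p ^ (m - 1) = n 1 + n (- 1)" using S[of "\<lambda>e. e\<^sup>2"] sum_eps(2)[OF c] by simp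
  ultimately have "real_of_int (int p ^ m) = n (- 1) + n 0 + n 1"
    "real_of_int (int p ^ h) = n 1 - n (- 1)" "real_of_int (int p ^ (m - 1)) = n 1 + n (- 1)"
    by (simp_all only: of_int_add of_int_diff)
  moreover have "n e = 0" if "e \<notin> {- 1, 0, 1}"
    using eps_range[OF c] that by (auto simp: n_def)
  moreover have "real (card {u. eps u c = e}) = real_of_int (n e)" by (simp add: n_def)
  ultimately show ?thesis unfolding eps_count_def by auto
qed

subsection \<open>Weights\<close>

definition half_exp :: nat where "half_exp = (p ^ k + 1) div 2"

lemma two_half_exp: "2 * half_exp = p ^ k + 1"
  unfolding half_exp_def using odd_p by simp

definition entry :: "'a \<Rightarrow> 'a \<Rightarrow> 'a \<Rightarrow> nat \<Rightarrow> 'a" where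
  "entry a b c t = tr (a * \<pi> ^ t + b * (- \<pi>) ^ t + c * \<pi> ^ (half_exp * t))"

lemma codeword_eq: "codeword p m k \<pi> a b c = map (entry a b c) [0..<p ^ m - 1]"
  by (simp add: codeword_def entry_def half_exp_def)

lemma entry_even: "entry a b c (2 * s) = qf (a + b) c (\<pi> ^ s)"
proof -
  have "\<pi> ^ (half_exp * (2 * s)) = (\<pi> ^ s) ^ (p ^ k + 1)"
    unfolding two_half_exp[symmetric] by (simp add: mult_ac flip: power_mult)
  moreover have "\<pi> ^ (2 * s) = (\<pi> ^ s)\<^sup>2" "(- \<pi>) ^ (2 * s) = (\<pi> ^ s)\<^sup>2"
    using power_even_eq[of \<pi> s] by simp_all
  ultimately show ?thesis unfolding entry_def qf_def by (simp only: distrib_right)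
qed

lemma entry_odd: "entry a b c (2 * s + 1) = qf ((a - b) * \<pi>) (c * \<pi> ^ half_exp) (\<pi> ^ s)"
proof -
  have "\<pi> ^ (half_exp * (2 * s + 1)) = \<pi> ^ half_exp * (\<pi> ^ s) ^ (p ^ k + 1)"
    unfolding two_half_exp[symmetric] by (simp add: power_add algebra_simps flip: power_mult)
  moreover have "a * \<pi> ^ (2 * s + 1) + b * (- \<pi>) ^ (2 * s + 1) = (a - b) * \<pi> * (\<pi> ^ s)\<^sup>2"
    using power_even_eq[of \<pi> s] by (simp add: algebra_simps)
  ultimately show ?thesis unfolding entry_def qf_def by (simp only: mult.assoc)
qed

text \<open>The form is even and \<open>\<pi> ^ ((p ^ m - 1) div 2) = - 1\<close>, so the exponents
  below half the length meet each pair of opposite nonzero elements once.\<close>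

lemma card_qf_nonzero: "card {x. qf u c x \<noteq> 0} = 2 * card {s. s < (p ^ m - 1) div 2 \<and> qf u c (\<pi> ^ s) \<noteq> 0}"
proof -
  let ?M = "(p ^ m - 1) div 2"
  let ?A = "{s. s < ?M \<and> qf u c (\<pi> ^ s) \<noteq> 0}"
  have ev: "p ^ m - 1 = 2 * ?M" using odd_p by simp
  have shift: "qf u c (\<pi> ^ (?M + s)) = qf u c (\<pi> ^ s)" for s
    unfolding power_add pi_power_half by (simp add: qf_minus)
  have "bij_betw (\<lambda>i. \<pi> ^ i) {t. t < p ^ m - 1 \<and> qf u c (\<pi> ^ t) \<noteq> 0} {x. qf u c x \<noteq> 0}"
  proof (rule bij_betw_subset[OF bij_betw_pi_power])
    have "x \<in> (\<lambda>i. \<pi> ^ i) ` {t. t < p ^ m - 1 \<and> qf u c (\<pi> ^ t) \<noteq> 0}" if "qf u c x \<noteq> 0" for x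
    proof -
      have "x \<in> UNIV - {0}" using that by auto
      then obtain t where "t < p ^ m - 1" "x = \<pi> ^ t"
        using bij_betw_imp_surj_on[OF bij_betw_pi_power] by blast
      then show ?thesis using that by blast
    qed
    then show "(\<lambda>i. \<pi> ^ i) ` {t. t < p ^ m - 1 \<and> qf u c (\<pi> ^ t) \<noteq> 0} = {x. qf u c x \<noteq> 0}" by auto
  qed auto
  then have "card {x. qf u c x \<noteq> 0} = card {t. t < p ^ m - 1 \<and> qf u c (\<pi> ^ t) \<noteq> 0}"
    by (rule bij_betw_same_card[symmetric])
  also have "{t. t < p ^ m - 1 \<and> qf u c (\<pi> ^ t) \<noteq> 0} = ?A \<union> (\<lambda>s. ?M + s) ` ?A" (is "?L = _")
  proof
    show "?L \<subseteq> ?A \<union> (\<lambda>s. ?M + s) ` ?A"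
    proof
      fix t assume t: "t \<in> ?L"
      show "t \<in> ?A \<union> (\<lambda>s. ?M + s) ` ?A"
      proof (cases "t < ?M")
        case False
        then obtain s where s: "t = ?M + s" using le_Suc_ex not_less by blast
        then have "?M + s < 2 * ?M" "qf u c (\<pi> ^ s) \<noteq> 0"
          using t unfolding mem_Collect_eq s shift ev[symmetric] by blast+
        then have "s \<in> ?A" by simp
        then show ?thesis unfolding s by blast
      qed (use t in auto)
    qed
    show "?A \<union> (\<lambda>s. ?M + s) ` ?A \<subseteq> ?L"
    proof (intro Un_least image_subsetI)
      show "?A \<subseteq> ?L" by auto
      show "?M + s \<in> ?L" if "s \<in> ?A" for s
        using that unfolding mem_Collect_eq shift by linarith
    qed
  qed
  also have "card \<dots> = card ?A + card ((\<lambda>s. ?M + s) ` ?A)"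
    by (rule card_Un_disjoint) auto
  finally show ?thesis by (simp add: card_image)
qed

lemma hamming_weight_codeword:
  "2 * hamming_weight (codeword p m k \<pi> a b c) =
     card {x. qf (a + b) c x \<noteq> 0} + card {x. qf ((a - b) * \<pi>) (c * \<pi> ^ half_exp) x \<noteq> 0}"
proof -
  have ev: "p ^ m - 1 = 2 * ((p ^ m - 1) div 2)" using odd_p by simp
  have "hamming_weight (codeword p m k \<pi> a b c) = card {t. t < 2 * ((p ^ m - 1) div 2) \<and> entry a b c t \<noteq> 0}"
    unfolding codeword_eq hamming_weight_map_upt using ev by simp
  then show ?thesis
    unfolding card_less_double entry_even entry_odd card_qf_nonzero by simp
qed

lemma real_card_qf_nonzero:
  "real (card {x. qf u c x \<noteq> 0}) = (real p - 1) * (real p ^ (m - 1) - eps u c * real p ^ h)"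
proof -
  have "{x. qf u c x \<noteq> 0} = UNIV - {x. qf u c x = 0}" by auto
  then have "int (card {x. qf u c x \<noteq> 0}) = int p ^ m - int (zeros u c)"
    using card_mono[of UNIV "{x. qf u c x = 0}"]
    by (simp add: card_Diff_subset zeros_def of_nat_diff card_UNIV)
  also have "\<dots> = (int p - 1) * (int p ^ (m - 1) - eps u c * int p ^ h)"
    unfolding zeros_eq_eps pow_m_eq by (simp add: algebra_simps)
  finally have "real_of_int (int (card {x. qf u c x \<noteq> 0})) = real_of_int \<dots>" by (rule arg_cong)
  then show ?thesis by simp
qed

text \<open>The weight is an injective affine function of this integer, by
  \<open>real_hamming_weight\<close>, so weights can be counted by type.\<close>

definition code_type :: "'a \<Rightarrow> 'a \<Rightarrow> 'a \<Rightarrow> int" where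
  "code_type a b c = eps (a + b) c + eps ((a - b) * \<pi>) (c * \<pi> ^ half_exp)"

lemma real_hamming_weight:
  "real (hamming_weight (codeword p m k \<pi> a b c)) =
     (real p - 1) / 2 * (2 * real p ^ (m - 1) - code_type a b c * real p ^ h)"
proof -
  have "real (2 * hamming_weight (codeword p m k \<pi> a b c)) =
      (real p - 1) * (real p ^ (m - 1) - eps (a + b) c * real p ^ h) +
      (real p - 1) * (real p ^ (m - 1) - eps ((a - b) * \<pi>) (c * \<pi> ^ half_exp) * real p ^ h)"
    unfolding hamming_weight_codeword of_nat_add real_card_qf_nonzero ..
  moreover have "W = (q - 1) / 2 * (2 * P - (x + y) * H)"
    if "2 * W = (q - 1) * (P - x * H) + (q - 1) * (P - y * H)" for W q P H x y :: real
    using that by (simp add: field_simps)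
  ultimately show ?thesis unfolding code_type_def of_int_add of_nat_mult of_nat_numeral by blast
qed

text \<open>A change of variables, invertible as 2 and \<open>\<pi>\<close> are nonzero. It makes
  the two summands of the type independent of each other.\<close>

lemma card_code_type:
  "card {(a, b). code_type a b c = s} = card {(u, v). eps u c + eps v (c * \<pi> ^ half_exp) = s}"
proof (rule bij_betw_same_card)
  show "bij_betw (\<lambda>(a, b). (a + b, (a - b) * \<pi>)) {(a, b). code_type a b c = s}
     {(u, v). eps u c + eps v (c * \<pi> ^ half_exp) = s}"
    by (rule bij_betw_byWitness[where f' = "\<lambda>(u, v). ((u + v / \<pi>) / 2, (u - v / \<pi>) / 2)"])
       (use pi_nonzero two_nonzero in \<open>auto simp: code_type_def
          add_divide_distrib[symmetric] diff_divide_distrib[symmetric] mult_2[symmetric]\<close>)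
qed

text \<open>For \<open>c \<noteq> 0\<close> both forms have a nonzero second parameter, so both
  summands of the type are distributed as in \<open>eps_count\<close>.\<close>

definition type_count :: "int \<Rightarrow> real" where
  "type_count s = (\<Sum>i\<in>{- 1, 0, 1}. eps_count i * eps_count (s - i))"

text \<open>For \<open>c = 0\<close> a summand is \<open>p ^ h\<close> if its form is zero and 0
  otherwise; the cases are two, one or no zero forms.\<close>

definition type_count_0 :: "int \<Rightarrow> real" where
  "type_count_0 s = (if s = 2 * int p ^ h then 1 else if s = int p ^ h then 2 * (real p ^ m - 1)
     else if s = 0 then (real p ^ m - 1)\<^sup>2 else 0)"

lemma card_code_type_nonzero:
  assumes "c \<noteq> 0"
  shows "real (card {(a, b). code_type a b c = s}) = type_count s"
  unfolding card_code_type type_count_def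
  by (subst card_sum_eq[of "{- 1, 0, 1}"])
     (use eps_range[OF assms] assms pi_nonzero in \<open>auto simp: card_eps\<close>)

lemma card_code_type_0: "real (card {(a, b). code_type a b 0 = s}) = type_count_0 s"
proof -
  have H: "int p ^ h \<noteq> 0" using p_ge_3 by simp
  have n: "card {u. eps u 0 = i} = (if i = int p ^ h then 1 else if i = 0 then p ^ m - 1 else 0)" for i
  proof -
    have "{u. eps u 0 = i} = (if i = int p ^ h then {0} else if i = 0 then UNIV - {0} else {})"
      using H by (auto simp: eps_0)
    then show ?thesis by (simp add: card_Diff_subset card_UNIV)
  qed
  have "card {(a, b). code_type a b 0 = s} = (\<Sum>i\<in>{0, int p ^ h}. card {u. eps u 0 = i} * card {v. eps v 0 = s - i})"
    unfolding card_code_type mult_zero_left by (rule card_sum_eq) (auto simp: eps_0)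
  also have "real \<dots> = type_count_0 s"
    using H p_pow_m_ge by (auto simp: n type_count_0_def of_nat_diff power2_eq_square)
  finally show ?thesis .
qed

lemma weight_freq_eq:
  "real (weight_freq p m k \<pi> ((real p - 1) / 2 * (2 * real p ^ (m - 1) - real_of_int s * real p ^ h))) =
     type_count_0 s + (real p ^ m - 1) * type_count s"
proof -
  have "real (hamming_weight (codeword p m k \<pi> a b c)) =
      (real p - 1) / 2 * (2 * real p ^ (m - 1) - real_of_int s * real p ^ h) \<longleftrightarrow> code_type a b c = s" for a b c
    unfolding real_hamming_weight using p_ge_3 by simp
  then have "weight_freq p m k \<pi> ((real p - 1) / 2 * (2 * real p ^ (m - 1) - real_of_int s * real p ^ h)) =
      card {(a, b, c). code_type a b c = s}"
    unfolding weight_freq_def by simp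
  also have "\<dots> = card (SIGMA c:UNIV. {(a, b). code_type a b c = s})"
    by (rule bij_betw_same_card[of "\<lambda>(a, b, c). (c, a, b)"],
        rule bij_betw_byWitness[where f' = "\<lambda>(c, a, b). (a, b, c)"]) auto
  also have "\<dots> = (\<Sum>c\<in>UNIV. card {(a, b). code_type a b c = s})" by simp
  also have "\<dots> = card {(a, b). code_type a b 0 = s} + (\<Sum>c\<in>UNIV - {0}. card {(a, b). code_type a b c = s})"
    by (rule sum.remove) auto
  also have "real \<dots> = type_count_0 s + (\<Sum>c\<in>UNIV - {0::'a}. type_count s)"
    by (simp add: card_code_type_0 card_code_type_nonzero)
  also have "(\<Sum>c\<in>UNIV - {0::'a}. type_count s) = (real p ^ m - 1) * type_count s"
    using p_pow_m_ge by (simp add: card_Diff_subset card_UNIV of_nat_diff)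
  finally show ?thesis .
qed

lemma code_type_range:
  "code_type a b c \<in> {- 2, - 1, 0, 1, 2} \<or> code_type a b c \<in> {0, int p ^ h, 2 * int p ^ h}"
proof (cases "c = 0")
  case False
  then have "c * \<pi> ^ half_exp \<noteq> 0" using pi_nonzero by simp
  then show ?thesis
    using eps_range[OF False, of "a + b"] eps_range[of "c * \<pi> ^ half_exp" "(a - b) * \<pi>"]
    unfolding code_type_def by auto
qed (auto simp: code_type_def eps_0)

subsection \<open>Parameters of the code\<close>

text \<open>This keeps the types \<open>p ^ h\<close> and \<open>2 * p ^ h\<close>, which come from
  \<open>c = 0\<close>, apart from those between -2 and 2.\<close>

lemma real_pow_h_ge: "real p ^ h \<ge> 3" and int_pow_h_ge: "int p ^ h \<ge> 3"
proof -
  have "p \<le> p ^ h" using m_eq m_ge_3 p_ge_3 by (intro self_le_power) auto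
  then have *: "3 \<le> p ^ h" using p_ge_3 by simp
  show "real p ^ h \<ge> 3" using * by (metis of_nat_le_iff of_nat_numeral of_nat_power)
  show "int p ^ h \<ge> 3" using * by (metis of_nat_le_iff of_nat_numeral of_nat_power)
qed

lemma real_pow_h_square: "real p ^ (m - 1) = real p ^ h * real p ^ h"
  using pow_h_square by (metis of_int_mult of_int_of_nat_eq of_int_power)

lemma entry_add: "entry a b c t + entry a' b' c' t = entry (a + a') (b + b') (c + c') t"
  unfolding entry_def tr_add[symmetric] by (rule arg_cong[where f = tr]) (simp add: algebra_simps)

lemma entry_scale: "s \<in> F \<Longrightarrow> s * entry a b c t = entry (s * a) (s * b) (s * c) t"
  unfolding entry_def by (subst tr_scale[symmetric]) (auto simp: algebra_simps)

lemma entry_zero: "entry 0 0 0 t = 0"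
  by (simp add: entry_def)

lemma entry_Suc: "entry a b c (Suc t) = entry (a * \<pi>) (- (b * \<pi>)) (c * \<pi> ^ half_exp) t"
  unfolding entry_def by (rule arg_cong[where f = tr]) (simp add: power_add mult_ac)

text \<open>The length is even, so the sign of \<open>- \<pi>\<close> disappears; this closes the
  cycle for \<open>rotate1_map_upt\<close>.\<close>

lemma entry_period: "entry a b c (p ^ m - 1) = entry a b c 0"
proof -
  have ev: "even (p ^ m - 1)" using odd_p by simp
  have "(- \<pi>) ^ (p ^ m - 1) = 1" using pi_power_n by (simp add: power_minus_even[OF ev] ev del: One_nat_def)
  moreover have "\<pi> ^ (half_exp * (p ^ m - 1)) = 1"
    using pi_power_n by (metis mult.commute power_mult power_one)
  ultimately show ?thesis by (simp add: entry_def pi_power_n del: One_nat_def)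
qed

lemma code_eq: "code_pmk p m k \<pi> = range (\<lambda>(a, b, c). map (entry a b c) [0..<p ^ m - 1])"
  unfolding code_pmk_def codeword_eq by (auto simp: image_iff simp del: map_eq_conv, blast)

lemma code_pmkI: "map (entry a b c) [0..<p ^ m - 1] \<in> code_pmk p m k \<pi>"
  unfolding code_eq by (rule range_eqI[of _ _ "(a, b, c)"]) simp

lemma code_pmkE:
  assumes "v \<in> code_pmk p m k \<pi>"
  obtains a b c where "v = map (entry a b c) [0..<p ^ m - 1]"
  using assms unfolding code_eq by auto

lemma cyclic: "cyclic_code (p ^ m - 1) (code_pmk p m k \<pi>)"
  unfolding cyclic_code_def
proof (intro conjI ballI)
  fix v assume "v \<in> code_pmk p m k \<pi>"
  then obtain a b c where v: "v = map (entry a b c) [0..<p ^ m - 1]" by (rule code_pmkE)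
  show "length v = p ^ m - 1" "set v \<subseteq> F" unfolding v by (auto simp: entry_def)
  have "rotate1 v = map (entry (a * \<pi>) (- (b * \<pi>)) (c * \<pi> ^ half_exp)) [0..<p ^ m - 1]"
    unfolding v by (subst rotate1_map_upt) (auto simp: entry_period entry_Suc simp del: One_nat_def)
  then show "rotate1 v \<in> code_pmk p m k \<pi>" by (simp only: code_pmkI)
  fix s :: 'a assume "s \<in> F"
  then have "map ((*) s) v = map (entry (s * a) (s * b) (s * c)) [0..<p ^ m - 1]"
    unfolding v by (simp add: entry_scale)
  then show "map ((*) s) v \<in> code_pmk p m k \<pi>" by (simp only: code_pmkI)
next
  fix u v assume "u \<in> code_pmk p m k \<pi>" "v \<in> code_pmk p m k \<pi>"
  then obtain a b c a' b' c' where "u = map (entry a b c) [0..<p ^ m - 1]"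
    "v = map (entry a' b' c') [0..<p ^ m - 1]" by (metis code_pmkE)
  then have "map2 (+) u v = map (entry (a + a') (b + b') (c + c')) [0..<p ^ m - 1]"
    by (simp add: map2_map_map entry_add)
  then show "map2 (+) u v \<in> code_pmk p m k \<pi>" by (simp only: code_pmkI)
next
  have "replicate (p ^ m - 1) 0 = map (entry 0 0 0) [0..<p ^ m - 1]"
    by (rule nth_equalityI) (auto simp: entry_zero)
  then show "replicate (p ^ m - 1) 0 \<in> code_pmk p m k \<pi>" by (simp only: code_pmkI)
qed

text \<open>Each weight belongs to one \<open>code_type\<close>: weight 0 to
  \<open>2 * int p ^ h\<close>, as \<open>p ^ (m - 1)\<close> is the square of \<open>p ^ h\<close>;
  the second weight to \<open>int p ^ h\<close>; the other five to 1, -1, 2, -2 and 0, in this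
  order.\<close>

lemma weight_freqs:
  defines "q \<equiv> real p"
  shows "real (weight_freq p m k \<pi> 0) = 1"
    "real (weight_freq p m k \<pi> ((q - 1) / 2 * q ^ (m - 1))) = 2 * (q ^ m - 1)"
    "real (weight_freq p m k \<pi> ((q - 1) / 2 * (2 * q ^ (m - 1) - q ^ h))) =
           (q ^ m - 1) * (q ^ m - q ^ (m - 1)) * (q ^ (m - 1) + q ^ h)"
    "real (weight_freq p m k \<pi> ((q - 1) / 2 * (2 * q ^ (m - 1) + q ^ h))) =
           (q ^ m - 1) * (q ^ m - q ^ (m - 1)) * (q ^ (m - 1) - q ^ h)"
    "real (weight_freq p m k \<pi> ((q - 1) * (q ^ (m - 1) - q ^ h))) =
           1 / 4 * (q ^ m - 1) * (q ^ (m - 1) + q ^ h) ^ 2"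
    "real (weight_freq p m k \<pi> ((q - 1) * (q ^ (m - 1) + q ^ h))) =
           1 / 4 * (q ^ m - 1) * (q ^ (m - 1) - q ^ h) ^ 2"
    "real (weight_freq p m k \<pi> ((q - 1) * q ^ (m - 1))) =
           (q ^ m - 1) * (q ^ (2 * m) + 3 / 2 * q ^ (2 * (m - 1)) - 2 * q ^ (2 * m - 1)
             + q ^ m - 1 / 2 * q ^ (m - 1) - 1)"
proof -
  define P H Q where "P = q ^ (m - 1)" and "H = q ^ h" and "Q = q ^ m"
  have PH: "P = H * H" unfolding P_def H_def q_def by (rule real_pow_h_square)
  have int_H: "real_of_int (int p ^ h) = H" by (simp add: H_def q_def)
  have freq: "real (weight_freq p m k \<pi> w) = type_count_0 s + (Q - 1) * type_count s"
    if "w = (q - 1) / 2 * (2 * P - real_of_int s * H)" for w s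
    unfolding that unfolding q_def P_def H_def Q_def by (rule weight_freq_eq)
  have cnt: "type_count 1 = (Q - P) * (P + H)" "type_count (- 1) = (Q - P) * (P - H)"
    "type_count 2 = (P + H)\<^sup>2 / 4" "type_count (- 2) = (P - H)\<^sup>2 / 4"
    "type_count 0 = (Q - P)\<^sup>2 + (P + H) * (P - H) / 2"
    by (simp_all add: type_count_def eps_count_def P_def H_def Q_def q_def power2_eq_square field_simps)
  \<comment> \<open>Triples with \<open>c \<noteq> 0\<close> contribute nothing to the types
    \<open>int p ^ h\<close> and \<open>2 * int p ^ h\<close>.\<close>
  have big: "type_count s = 0" if "s \<ge> 3" for s
    using that by (simp add: type_count_def eps_count_def)
  have cnt0: "type_count_0 1 = 0" "type_count_0 (- 1) = 0" "type_count_0 2 = 0"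
    "type_count_0 (- 2) = 0" "type_count_0 0 = (Q - 1)\<^sup>2"
    "type_count_0 (int p ^ h) = 2 * (Q - 1)" "type_count_0 (2 * int p ^ h) = 1"
    using int_pow_h_ge p_ge_3 by (auto simp: type_count_0_def Q_def q_def)
  show "real (weight_freq p m k \<pi> 0) = 1"
    using freq[of 0 "2 * int p ^ h"] big[of "2 * int p ^ h"] int_pow_h_ge
    by (simp add: int_H cnt0 PH H_def q_def)
  show "real (weight_freq p m k \<pi> ((q - 1) / 2 * q ^ (m - 1))) = 2 * (q ^ m - 1)"
    unfolding P_def[symmetric] Q_def[symmetric]
    using freq[of "(q - 1) / 2 * P" "int p ^ h"] big[of "int p ^ h"] int_pow_h_ge
    by (simp only: int_H cnt0 PH) simp
  show "real (weight_freq p m k \<pi> ((q - 1) / 2 * (2 * q ^ (m - 1) - q ^ h))) =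
           (q ^ m - 1) * (q ^ m - q ^ (m - 1)) * (q ^ (m - 1) + q ^ h)"
    unfolding P_def[symmetric] Q_def[symmetric] H_def[symmetric]
    by (subst freq[of _ 1]) (simp_all add: cnt cnt0)
  show "real (weight_freq p m k \<pi> ((q - 1) / 2 * (2 * q ^ (m - 1) + q ^ h))) =
           (q ^ m - 1) * (q ^ m - q ^ (m - 1)) * (q ^ (m - 1) - q ^ h)"
    unfolding P_def[symmetric] Q_def[symmetric] H_def[symmetric]
    by (subst freq[of _ "- 1"]) (simp_all add: cnt cnt0)
  show "real (weight_freq p m k \<pi> ((q - 1) * (q ^ (m - 1) - q ^ h))) =
           1 / 4 * (q ^ m - 1) * (q ^ (m - 1) + q ^ h) ^ 2"
    unfolding P_def[symmetric] Q_def[symmetric] H_def[symmetric]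
    by (subst freq[of _ 2]) (simp_all add: cnt cnt0 field_simps)
  show "real (weight_freq p m k \<pi> ((q - 1) * (q ^ (m - 1) + q ^ h))) =
           1 / 4 * (q ^ m - 1) * (q ^ (m - 1) - q ^ h) ^ 2"
    unfolding P_def[symmetric] Q_def[symmetric] H_def[symmetric]
    by (subst freq[of _ "- 2"]) (simp_all add: cnt cnt0 field_simps)
  have pw: "q ^ (2 * m) = Q * Q" "q ^ (2 * (m - 1)) = P * P" "q ^ (2 * m - 1) = Q * P"
  proof -
    have "2 * m - 1 = m + (m - 1)" using m_ge_3 by simp
    then show "q ^ (2 * m - 1) = Q * P" by (simp only: power_add Q_def P_def)
  qed (simp_all only: mult_2 power_add Q_def P_def)
  have "(Q - 1)\<^sup>2 + (Q - 1) * ((Q - P)\<^sup>2 + (P + H) * (P - H) / 2) =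
    (Q - 1) * (Q * Q + 3 / 2 * (P * P) - 2 * (Q * P) + Q - 1 / 2 * P - 1)"
    unfolding PH by (simp add: power2_eq_square field_simps)
  moreover have "real (weight_freq p m k \<pi> ((q - 1) * P)) =
      (Q - 1)\<^sup>2 + (Q - 1) * ((Q - P)\<^sup>2 + (P + H) * (P - H) / 2)"
    by (subst freq[of _ 0]) (simp_all add: cnt cnt0)
  ultimately show "real (weight_freq p m k \<pi> ((q - 1) * q ^ (m - 1))) =
           (q ^ m - 1) * (q ^ (2 * m) + 3 / 2 * q ^ (2 * (m - 1)) - 2 * q ^ (2 * m - 1)
             + q ^ m - 1 / 2 * q ^ (m - 1) - 1)"
    unfolding pw unfolding P_def[symmetric] Q_def[symmetric] by simp
qed

lemma weight_values:
  defines "q \<equiv> real p"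
  shows "real (hamming_weight (codeword p m k \<pi> a b c)) \<in>
           {0, (q - 1) / 2 * q ^ (m - 1),
            (q - 1) / 2 * (2 * q ^ (m - 1) - q ^ h),
            (q - 1) / 2 * (2 * q ^ (m - 1) + q ^ h),
            (q - 1) * (q ^ (m - 1) - q ^ h),
            (q - 1) * (q ^ (m - 1) + q ^ h),
            (q - 1) * q ^ (m - 1)}"
  using code_type_range[of a b c] unfolding real_hamming_weight q_def real_pow_h_square
  by (auto simp: field_simps)

text \<open>The map is additive, and by \<open>weight_freqs\<close> exactly one triple has weight 0.
  The dimension thus comes out of the weight distribution.\<close>

lemma inj_codeword: "inj (\<lambda>(a, b, c). map (entry a b c) [0..<p ^ m - 1])"
proof -
  have "card {(a, b, c). real (hamming_weight (codeword p m k \<pi> a b c)) = 0} = 1"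
    using weight_freqs(1) unfolding weight_freq_def by simp
  then obtain z where z: "{(a, b, c). real (hamming_weight (codeword p m k \<pi> a b c)) = 0} = {z}"
    by (rule card_1_singletonE)
  have zero: "a = 0 \<and> b = 0 \<and> c = 0" if "\<And>t. t < p ^ m - 1 \<Longrightarrow> entry a b c t = 0" for a b c
  proof -
    have "(a, b, c) \<in> {z}" "(0, 0, 0) \<in> {z}"
      unfolding z[symmetric] codeword_eq hamming_weight_map_upt using that by (auto simp: entry_zero)
    then have "(a, b, c) = (0, 0, 0)" by (metis singletonD)
    then show ?thesis by simp
  qed
  show ?thesis
  proof (rule injI)
    fix x y :: "'a \<times> 'a \<times> 'a"
    assume xy: "(\<lambda>(a, b, c). map (entry a b c) [0..<p ^ m - 1]) x =
      (\<lambda>(a, b, c). map (entry a b c) [0..<p ^ m - 1]) y"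
    obtain a b c a' b' c' where x: "x = (a, b, c)" and y: "y = (a', b', c')"
      by (cases x, cases y) auto
    have eq: "map (entry a b c) [0..<p ^ m - 1] = map (entry a' b' c') [0..<p ^ m - 1]"
      using xy unfolding x y by simp
    have "entry (a - a') (b - b') (c - c') t = 0" if "t < p ^ m - 1" for t
    proof -
      have "entry a b c t = entry a' b' c' t" using eq that by (auto simp: map_eq_conv)
      then show ?thesis using entry_add[of "a - a'" "b - b'" "c - c'" t a' b' c'] by simp
    qed
    then show "x = y" using zero[of "a - a'" "b - b'" "c - c'"] by (simp add: x y)
  qed
qed

lemma dimension: "code_dim p (code_pmk p m k \<pi>) = 3 * m"
proof -
  have "card (code_pmk p m k \<pi>) = CARD('a \<times> 'a \<times> 'a)"
    unfolding code_eq by (rule card_image) (rule inj_codeword)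
  also have "\<dots> = p ^ (m + (m + m))" by (simp add: card_UNIV power_add)
  also have "m + (m + m) = 3 * m" by simp
  finally show ?thesis
    unfolding code_dim_def using p_ge_3 by (intro the_equality) auto
qed

lemma minimum_distance: "real (min_distance (code_pmk p m k \<pi>)) = (real p - 1) / 2 * real p ^ (m - 1)"
proof -
  define K where "K = (p - 1) div 2 * p ^ (m - 1)"
  have "2 * ((p - 1) div 2) = p - 1" using odd_p by simp
  then have "real (2 * ((p - 1) div 2)) = real p - 1" using p_ge_3 by (simp only: of_nat_diff)
  then have "2 * real ((p - 1) div 2) = real p - 1" by simp
  then have K: "real K = (real p - 1) / 2 * real p ^ (m - 1)" by (simp add: K_def)
  have nz: "hamming_weight v > 0 \<longleftrightarrow> (\<exists>x\<in>set v. x \<noteq> 0)" for v :: "'a list"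
    by (auto simp: hamming_weight_def filter_empty_conv)
  let ?S = "{hamming_weight v | v. v \<in> code_pmk p m k \<pi> \<and> (\<exists>x\<in>set v. x \<noteq> 0)}"
  have "Min ?S = K"
  proof (rule Min_eqI)
    show "finite ?S" by (simp add: code_eq)
    show "K \<le> y" if "y \<in> ?S" for y
    proof -
      obtain v where v: "v \<in> code_pmk p m k \<pi>" "y = hamming_weight v" "y > 0"
        using \<open>y \<in> ?S\<close> nz by auto
      then obtain a b c where y: "y = hamming_weight (codeword p m k \<pi> a b c)"
        unfolding codeword_eq by (metis code_pmkE)
      define H where "H = real p ^ h"
      have H: "H \<ge> 3" unfolding H_def by (rule real_pow_h_ge)
      then have "H * H \<ge> 3 * H" by (intro mult_right_mono) auto
      moreover have "real y \<noteq> 0" using v by simp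
      \<comment> \<open>For each nonzero weight \<open>x\<close> is at least \<open>H * H\<close>:
        the largest amount subtracted from \<open>2 * H * H\<close> is \<open>2 * H\<close>, and
        \<open>H \<ge> 3\<close>.\<close>
      ultimately have "\<exists>x. real y = (real p - 1) / 2 * x \<and> x \<ge> H * H"
        using weight_values[of a b c] H unfolding y[symmetric] real_pow_h_square H_def[symmetric]
        by (elim insertE emptyE)
          (auto intro: exI[of _ "2 * H * H - H"] exI[of _ "2 * H * H + H"] exI[of _ "2 * (H * H - H)"]
            exI[of _ "2 * (H * H + H)"] exI[of _ "2 * (H * H)"])
      then have "real y \<ge> (real p - 1) / 2 * (H * H)"
        using p_ge_3 by (auto intro!: mult_left_mono)
      then have "real y \<ge> real K" by (simp only: K real_pow_h_square H_def)
      then show ?thesis by simp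
    qed
    have "real (p ^ m) > 1" using p_pow_m_ge by linarith
    then have "real p ^ m > 1" by simp
    \<comment> \<open>The bound is attained because its frequency \<open>2 * (p ^ m - 1)\<close> is
      not 0.\<close>
    then have "weight_freq p m k \<pi> (real K) \<noteq> 0"
      using weight_freqs(2) unfolding K by auto
    then obtain a b c where "hamming_weight (codeword p m k \<pi> a b c) = K"
      unfolding weight_freq_def by auto
    moreover have "K > 0" using p_ge_3 by (simp add: K_def)
    ultimately have "\<exists>x\<in>set (codeword p m k \<pi> a b c). x \<noteq> 0" "K = hamming_weight (codeword p m k \<pi> a b c)"
      using nz[of "codeword p m k \<pi> a b c"] by auto
    then show "K \<in> ?S" using code_pmkI[of a b c, folded codeword_eq] by blast
  qed
  then show ?thesis by (simp add: min_distance_def K)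
qed

end

theorem theorem3p6:
  fixes \<pi> :: "'a::{finite,field}" and p m k :: nat
  assumes "prime p" and "odd p"
    and "CARD('a) = p ^ m"
    and "odd m" and "m \<ge> 3"
    and "k > 0" and "coprime m k"
    and "primitive_element \<pi>"
  defines "C \<equiv> code_pmk p m k \<pi>"
    and "q \<equiv> real p"
    and "h \<equiv> (m - 1) div 2"
  shows "(cyclic_code (p ^ m - 1) C) \<and>
    (code_dim p C = 3 * m) \<and>
    (real (min_distance C) = (q - 1) / 2 * q ^ (m - 1)) \<and>
    (\<forall>a b c. real (hamming_weight (codeword p m k \<pi> a b c)) \<in>
           {0, (q - 1) / 2 * q ^ (m - 1),
            (q - 1) / 2 * (2 * q ^ (m - 1) - q ^ h),
            (q - 1) / 2 * (2 * q ^ (m - 1) + q ^ h),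
            (q - 1) * (q ^ (m - 1) - q ^ h),
            (q - 1) * (q ^ (m - 1) + q ^ h),
            (q - 1) * q ^ (m - 1)}) \<and>
    (real (weight_freq p m k \<pi> 0) = 1) \<and>
    (real (weight_freq p m k \<pi> ((q - 1) / 2 * q ^ (m - 1))) = 2 * (q ^ m - 1)) \<and>
    (real (weight_freq p m k \<pi> ((q - 1) / 2 * (2 * q ^ (m - 1) - q ^ h))) =
           (q ^ m - 1) * (q ^ m - q ^ (m - 1)) * (q ^ (m - 1) + q ^ h)) \<and>
    (real (weight_freq p m k \<pi> ((q - 1) / 2 * (2 * q ^ (m - 1) + q ^ h))) =
           (q ^ m - 1) * (q ^ m - q ^ (m - 1)) * (q ^ (m - 1) - q ^ h)) \<and>
    (real (weight_freq p m k \<pi> ((q - 1) * (q ^ (m - 1) - q ^ h))) =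
           1 / 4 * (q ^ m - 1) * (q ^ (m - 1) + q ^ h) ^ 2) \<and>
    (real (weight_freq p m k \<pi> ((q - 1) * (q ^ (m - 1) + q ^ h))) =
           1 / 4 * (q ^ m - 1) * (q ^ (m - 1) - q ^ h) ^ 2) \<and>
    (real (weight_freq p m k \<pi> ((q - 1) * q ^ (m - 1))) =
           (q ^ m - 1) * (q ^ (2 * m) + 3 / 2 * q ^ (2 * (m - 1)) - 2 * q ^ (2 * m - 1)
             + q ^ m - 1 / 2 * q ^ (m - 1) - 1))"
proof -
  interpret T: three_zero_code \<pi> p m k
    by unfold_locales (use assms in auto)
  have "T.h = h" by (simp add: T.h_def h_def)
  then show ?thesis
    using T.cyclic T.dimension T.minimum_distance T.weight_values T.weight_freqs
    unfolding C_def q_def by simp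
qed

end
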